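(* Let $\mathfrak{B}_0$ be the set of all $f\in\mathfrak{C}$ such that $\|f(0)\|\le\delta^*$ and $$\|f(\theta_1)-f(\theta_2)\|\le\frac{2G_*}{\alpha\Gamma(\alpha)}\,|\theta_1-\theta_2|^\alpha\quad\text{for all }\theta_1,\theta_2\ge 0\text{ with }|\theta_1-\theta_2|\le 1 .$$ Then $\mathfrak{B}_0$ is a $\mathcal{D}$-absorbing set of the Volterra semiflow $\{\mathcal{T}_t\}_{t\ge0}$ (that is, for every $\mathfrak{D}\in\mathcal{D}$ there is a $T\geq 0$ such that $\mathcal{T}_t\mathfrak{D}\subset\mathfrak{B}_0$ for all $t\ge T$), and $\mathfrak{B}_0$ is precompact with respect to the metric $d_{\mathfrak{C}}$.
   Context: Let $d\in\mathbb{N}$, $\alpha\in(0,1)$, and let $\langle\cdot,\cdot\rangle$, $\|\cdot\|$ be the standard inner product and norm of $\mathbb{R}^d$. Let $g:\mathbb{R}^d\to\mathbb{R}^d$ be locally Lipschitz and satisfy $\langle x,g(x)\rangle\le a-b\|x\|^2$ for all $x\in\mathbb{R}^d$, for some constants $a,b>0$. Put $\delta^*:=\sqrt{a/b+1}$, $B^*:=\{y\in\mathbb{R}^d:\|y\|\le\delta^*\}$ and $G_*:=\sup_{x\in B^*}\sqrt d\,\|g(x)\|$. $\Gamma$ is the Gamma function. Let $\mathfrak{C}:=C([0,\infty),\mathbb{R}^d)$ be the space of continuous functions $f:[0,\infty)\to\mathbb{R}^d$, with the metric $$d_{\mathfrak{C}}(f,h):=\|f(0)-h(0)\|+\sum_{k=1}^\infty\frac1{2^k}\frac{\sup_{\theta\in[0,k]}\|f(\theta)-h(\theta)\|}{1+\sup_{\theta\in[0,k]}\|f(\theta)-h(\theta)\|}.$$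 For $f\in\mathfrak{C}$ let $x_f\in\mathfrak{C}$ denote the solution of the Volterra integral equation $x_f(t)=f(t)+\frac1{\Gamma(\alpha)}\int_0^t(t-s)^{\alpha-1}g(x_f(s))\,ds$, $t\ge0$, and define for $t\ge0$ $$(\mathcal{T}_tf)(\theta):=f(t+\theta)+\frac1{\Gamma(\alpha)}\int_0^t(t+\theta-s)^{\alpha-1}g(x_f(s))\,ds,\quad\theta\ge0.$$ It is taken as known that $\{\mathcal{T}_t\}_{t\ge0}$ is a semiflow of continuous operators on $\mathfrak{C}$ (with the compact-open topology); it is called the Volterra semiflow. For $x_0\in\mathbb{R}^d$ let $id_{x_0}\in\mathfrak{C}$ be the constant function $id_{x_0}(\theta)\equiv x_0$. Let $\mathcal{D}$ be the collection of all sets of the form $\mathfrak{D}=\{id_{x_0}:x_0\in D_0\}$ with $D_0$ a bounded subset of $\mathbb{R}^d$. *)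

theory Defs
  imports "HOL-Analysis.Analysis"
begin

definition locally_lipschitz :: "('a::metric_space \<Rightarrow> 'b::metric_space) \<Rightarrow> bool" where
  "locally_lipschitz g \<longleftrightarrow> (\<forall>x. \<exists>r>0. \<exists>L. L-lipschitz_on (cball x r) g)"

definition dissipative :: "real \<Rightarrow> real \<Rightarrow> ('a::real_inner \<Rightarrow> 'a) \<Rightarrow> bool" where
  "dissipative a b g \<longleftrightarrow> (\<forall>x. x \<bullet> g x \<le> a - b * (norm x)\<^sup>2)"

definition delta_star :: "real \<Rightarrow> real \<Rightarrow> real" where
  "delta_star a b = sqrt (a / b + 1)"

definition G_star :: "real \<Rightarrow> real \<Rightarrow> (real ^ 'n \<Rightarrow> real ^ 'n) \<Rightarrow> real" where
  "G_star a b g = (SUP y\<in>cball 0 (delta_star a b). sqrt (real CARD('n)) * norm (g y))"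

(* C([0,\<infinity>), R^d): functions on the half-line are represented by total functions that
   are extensional on {0..}, so that equality of representatives is equality on [0,\<infinity>). *)
definition path_space :: "(real \<Rightarrow> real ^ 'n) set" where
  "path_space = {f \<in> extensional {0..}. continuous_on {0..} f}"

definition sup_dist :: "real \<Rightarrow> (real \<Rightarrow> real ^ 'n) \<Rightarrow> (real \<Rightarrow> real ^ 'n) \<Rightarrow> real" where
  "sup_dist r f h = (SUP \<theta>\<in>{0..r}. norm (f \<theta> - h \<theta>))"

(* The series runs over k \<ge> 1, whence the index shift. The value 0 outside the space is only
   there because Metric_space demands a globally nonnegative distance function. *)
definition path_dist :: "(real \<Rightarrow> real ^ 'n) \<Rightarrow> (real \<Rightarrow> real ^ 'n) \<Rightarrow> real" where
  "path_dist f h = (if f \<in> path_space \<and> h \<in> path_space then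
     norm (f 0 - h 0) +
     (\<Sum>k. 1 / 2 ^ Suc k * (sup_dist (real (Suc k)) f h / (1 + sup_dist (real (Suc k)) f h)))
     else 0)"

definition volterra_solution ::
  "real \<Rightarrow> (real ^ 'n \<Rightarrow> real ^ 'n) \<Rightarrow> (real \<Rightarrow> real ^ 'n) \<Rightarrow> (real \<Rightarrow> real ^ 'n) \<Rightarrow> bool" where
  "volterra_solution \<alpha> g f x \<longleftrightarrow> x \<in> path_space \<and>
     (\<forall>t\<ge>0. x t = f t + (1 / Gamma \<alpha>) *\<^sub>R
        integral {0..t} (\<lambda>s. (t - s) powr (\<alpha> - 1) *\<^sub>R g (x s)))"

(* The solution x_f; meaningful when the integral equation for f is uniquely solvable. *)
definition volterra_sol ::
  "real \<Rightarrow> (real ^ 'n \<Rightarrow> real ^ 'n) \<Rightarrow> (real \<Rightarrow> real ^ 'n) \<Rightarrow> (real \<Rightarrow> real ^ 'n)" where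
  "volterra_sol \<alpha> g f = (THE x. volterra_solution \<alpha> g f x)"

definition volterra_semiflow ::
  "real \<Rightarrow> (real ^ 'n \<Rightarrow> real ^ 'n) \<Rightarrow> real \<Rightarrow> (real \<Rightarrow> real ^ 'n) \<Rightarrow> (real \<Rightarrow> real ^ 'n)" where
  "volterra_semiflow \<alpha> g t f = (\<lambda>\<theta>\<in>{0..}. f (t + \<theta>) + (1 / Gamma \<alpha>) *\<^sub>R
     integral {0..t} (\<lambda>s. (t + \<theta> - s) powr (\<alpha> - 1) *\<^sub>R g (volterra_sol \<alpha> g f s)))"

definition const_path :: "real ^ 'n \<Rightarrow> real \<Rightarrow> real ^ 'n" where
  "const_path x\<^sub>0 = (\<lambda>\<theta>\<in>{0..}. x\<^sub>0)"

definition const_families :: "(real \<Rightarrow> real ^ 'n) set set" where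
  "const_families = {const_path ` D\<^sub>0 | D\<^sub>0. bounded D\<^sub>0}"

definition absorbing :: "(real \<Rightarrow> 'a \<Rightarrow> 'a) \<Rightarrow> 'a set set \<Rightarrow> 'a set \<Rightarrow> bool" where
  "absorbing S \<D> B \<longleftrightarrow> (\<forall>D\<in>\<D>. \<exists>T\<ge>0. \<forall>t\<ge>T. S t ` D \<subseteq> B)"

definition B_zero ::
  "real \<Rightarrow> real \<Rightarrow> real \<Rightarrow> (real ^ 'n \<Rightarrow> real ^ 'n) \<Rightarrow> (real \<Rightarrow> real ^ 'n) set" where
  "B_zero \<alpha> a b g = {f \<in> path_space. norm (f 0) \<le> delta_star a b \<and>
     (\<forall>\<theta>\<^sub>1\<ge>0. \<forall>\<theta>\<^sub>2\<ge>0. \<bar>\<theta>\<^sub>1 - \<theta>\<^sub>2\<bar> \<le> 1 \<longrightarrow>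
        norm (f \<theta>\<^sub>1 - f \<theta>\<^sub>2)
          \<le> 2 * G_star a b g / (\<alpha> * Gamma \<alpha>) * \<bar>\<theta>\<^sub>1 - \<theta>\<^sub>2\<bar> powr \<alpha>)}"

definition (in Metric_space) precompact_in :: "'a set \<Rightarrow> bool" where
  "precompact_in S \<longleftrightarrow> S \<subseteq> M \<and> compactin mtopology (mtopology closure_of S)"

lemma sup_dist_bdd:
  assumes "f \<in> path_space" "h \<in> path_space"
  shows "bdd_above ((\<lambda>\<theta>. norm (f \<theta> - h \<theta>)) ` {0..r})"
proof -
  have "continuous_on {0..r} (\<lambda>\<theta>. norm (f \<theta> - h \<theta>))"
    using assms unfolding path_space_def
    by (intro continuous_intros) (auto intro: continuous_on_subset)
  then show ?thesis
    by (intro bounded_imp_bdd_above compact_imp_bounded compact_continuous_image) auto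
qed

lemma sup_dist_upper:
  assumes "f \<in> path_space" "h \<in> path_space" "\<theta> \<in> {0..r}"
  shows "norm (f \<theta> - h \<theta>) \<le> sup_dist r f h"
  unfolding sup_dist_def using assms by (intro cSUP_upper sup_dist_bdd)

lemma sup_dist_nonneg:
  assumes "f \<in> path_space" "h \<in> path_space" "0 \<le> r"
  shows "0 \<le> sup_dist r f h"
  using sup_dist_upper[OF assms(1,2), of 0 r] assms(3)
  by (intro order_trans[OF norm_ge_zero[of "f 0 - h 0"]]) simp

lemma sup_dist_triangle:
  assumes "f \<in> path_space" "h \<in> path_space" "k \<in> path_space" "0 \<le> r"
  shows "sup_dist r f k \<le> sup_dist r f h + sup_dist r h k"
  unfolding sup_dist_def[of r f k]
proof (rule cSUP_least)
  fix \<theta> assume t: "\<theta> \<in> {0..r}"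
  have "norm (f \<theta> - k \<theta>) \<le> norm (f \<theta> - h \<theta>) + norm (h \<theta> - k \<theta>)"
    using norm_triangle_ineq[of "f \<theta> - h \<theta>" "h \<theta> - k \<theta>"] by simp
  with sup_dist_upper[OF assms(1,2) t] sup_dist_upper[OF assms(2,3) t]
  show "norm (f \<theta> - k \<theta>) \<le> sup_dist r f h + sup_dist r h k" by linarith
qed (use assms in auto)

lemma sup_dist_commute: "sup_dist r f h = sup_dist r h f"
  unfolding sup_dist_def by (simp add: norm_minus_commute)

lemma frac_subadd:
  fixes x y z :: real
  assumes "0 \<le> x" "0 \<le> y" "0 \<le> z" "x \<le> y + z"
  shows "x / (1 + x) \<le> y / (1 + y) + z / (1 + z)"
proof -
  define w where "w = y + z"
  have "0 < 1 + x" "0 < 1 + w" "x * (1 + w) \<le> w * (1 + x)"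
    using assms unfolding w_def by (auto simp: algebra_simps)
  then have "x / (1 + x) \<le> w / (1 + w)"
    by (simp only: pos_divide_le_eq pos_le_divide_eq times_divide_eq_left)
  then have "x / (1 + x) \<le> (y + z) / (1 + (y + z))" unfolding w_def .
  also have "\<dots> = y / (1 + (y + z)) + z / (1 + (y + z))"
    by (simp add: add_divide_distrib)
  also have "\<dots> \<le> y / (1 + y) + z / (1 + z)"
    using assms by (intro add_mono divide_left_mono mult_pos_pos) auto
  finally show ?thesis .
qed

lemma path_dist_summable:
  assumes "f \<in> path_space" "h \<in> path_space"
  shows "summable (\<lambda>k. 1 / 2 ^ Suc k *
           (sup_dist (real (Suc k)) f h / (1 + sup_dist (real (Suc k)) f h)))"
proof (rule summable_comparison_test')
  show "summable (\<lambda>k. (1 / 2 :: real) ^ Suc k)"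
    using summable_geometric[of "1 / 2 :: real"] by (subst summable_Suc_iff) simp
  fix k :: nat
  have nn: "0 \<le> sup_dist (real (Suc k)) f h"
    using assms by (intro sup_dist_nonneg) auto
  then have "sup_dist (real (Suc k)) f h / (1 + sup_dist (real (Suc k)) f h) \<le> 1"
    by simp
  then have "1 / 2 ^ Suc k * (sup_dist (real (Suc k)) f h / (1 + sup_dist (real (Suc k)) f h))
      \<le> 1 / 2 ^ Suc k * 1"
    by (intro mult_left_mono) auto
  with nn show "norm (1 / 2 ^ Suc k *
           (sup_dist (real (Suc k)) f h / (1 + sup_dist (real (Suc k)) f h))) \<le> (1 / 2) ^ Suc k"
    by (simp add: power_one_over)
qed

lemma path_term_nonneg:
  assumes "f \<in> path_space" "h \<in> path_space"
  shows "0 \<le> 1 / 2 ^ Suc k * (sup_dist (real (Suc k)) f h / (1 + sup_dist (real (Suc k)) f h))"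
  using sup_dist_nonneg[OF assms, of "real (Suc k)"]
  by (intro mult_nonneg_nonneg divide_nonneg_nonneg) auto

lemma path_dist_eq_0:
  assumes "f \<in> path_space" "h \<in> path_space" "path_dist f h = 0"
  shows "f = h"
proof -
  let ?a = "\<lambda>k. 1 / 2 ^ Suc k *
           (sup_dist (real (Suc k)) f h / (1 + sup_dist (real (Suc k)) f h))"
  have nn: "0 \<le> ?a k" for k by (rule path_term_nonneg[OF assms(1,2)])
  have sm: "summable ?a" by (rule path_dist_summable[OF assms(1,2)])
  have "0 \<le> suminf ?a" by (rule suminf_nonneg[OF sm nn])
  moreover have "norm (f 0 - h 0) + suminf ?a = 0"
    using assms unfolding path_dist_def by simp
  ultimately have "suminf ?a = 0"
    using norm_ge_zero[of "f 0 - h 0"] by linarith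
  then have z: "\<forall>k. ?a k = 0" using suminf_eq_zero_iff[OF sm nn] by simp
  have s0: "sup_dist (real (Suc k)) f h = 0" for k
  proof -
    have "?a k = 0" using z by blast
    then show ?thesis
      using sup_dist_nonneg[OF assms(1,2), of "real (Suc k)"]
      by (simp only: mult_eq_0_iff divide_eq_0_iff) auto
  qed
  have "f \<theta> = h \<theta>" if "0 \<le> \<theta>" for \<theta>
  proof -
    obtain k :: nat where "\<theta> \<le> real k" using real_arch_simple by blast
    then have "\<theta> \<in> {0..real (Suc k)}" using that by auto
    from sup_dist_upper[OF assms(1,2) this] s0[of k] show ?thesis by simp
  qed
  then show ?thesis
    using assms(1,2) unfolding path_space_def
    by (intro extensionalityI[of f "{0..}" h]) auto
qed

lemma path_dist_triangle:
  assumes "f \<in> path_space" "h \<in> path_space" "k \<in> path_space"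
  shows "path_dist f k \<le> path_dist f h + path_dist h k"
proof -
  let ?a = "\<lambda>f h j. 1 / 2 ^ Suc j *
           (sup_dist (real (Suc j)) f h / (1 + sup_dist (real (Suc j)) f h))"
  have "?a f k j \<le> ?a f h j + ?a h k j" for j
    unfolding distrib_left[symmetric]
    using assms by (intro mult_left_mono frac_subadd sup_dist_nonneg sup_dist_triangle) auto
  then have "suminf (?a f k) \<le> (\<Sum>j. ?a f h j + ?a h k j)"
    by (intro suminf_le summable_add path_dist_summable assms) auto
  also have "\<dots> = suminf (?a f h) + suminf (?a h k)"
    by (intro suminf_add[symmetric] path_dist_summable assms)
  finally have "suminf (?a f k) \<le> suminf (?a f h) + suminf (?a h k)" .
  moreover have "norm (f 0 - k 0) \<le> norm (f 0 - h 0) + norm (h 0 - k 0)"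
    using norm_triangle_ineq[of "f 0 - h 0" "h 0 - k 0"] by simp
  ultimately show ?thesis
    using assms unfolding path_dist_def by (simp only: simp_thms if_True)
qed

interpretation path: Metric_space path_space path_dist
proof
  fix f h k :: "real \<Rightarrow> real ^ 'n"
  show "path_dist f h = path_dist h f"
    unfolding path_dist_def sup_dist_commute[of _ f h] norm_minus_commute[of "f 0" "h 0"]
    by (simp only: conj_commute)
  show "0 \<le> path_dist f h"
  proof (cases "f \<in> path_space \<and> h \<in> path_space")
    case True
    then show ?thesis
      unfolding path_dist_def if_P[OF True]
      by (intro add_nonneg_nonneg norm_ge_zero suminf_nonneg path_dist_summable path_term_nonneg) auto
  next
    case False
    then show ?thesis unfolding path_dist_def if_not_P[OF False] by simp
  qed
  assume fh: "f \<in> path_space" "h \<in> path_space"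
  show "path_dist f h = 0 \<longleftrightarrow> f = h"
  proof
    assume "f = h"
    then show "path_dist f h = 0"
      unfolding path_dist_def by (simp add: sup_dist_def)
  qed (rule path_dist_eq_0[OF fh])
  assume "k \<in> path_space"
  with fh show "path_dist f k \<le> path_dist f h + path_dist h k"
    by (rule path_dist_triangle)
qed

end

theory Submission
  imports Defs "HOL-Complex_Analysis.Great_Picard"
begin

text \<open>
  Write c = 1 / Gamma \<alpha>, m = a / b + 1 (the square of the radius of the ball B*) and, for a
  constant datum x0, x t = x0 + c I(t), where I is the weakly singular integral of y = g (x _) with
  kernel (t - s) powr (\<alpha> - 1), called \<open>abel_integral\<close> below.

  The heart of the matter is that the squared norm V of x enters [0, m] for good after a time that depends
  on x0 only through a bound for its norm. Formally the fractional derivative of V is at most 2 x \<bullet> g x, which is at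
  most -2 b as soon as V \<ge> m; but x is only known to be Hoelder continuous, so no classical derivative is
  available. The derivative is therefore used in truncated Marchaud form: for 0 < \<epsilon> < \<tau>,

    \<tau> powr - \<alpha> * (\<phi> \<tau> - \<phi> 0) + \<alpha> * (integral over 0 \<le> s \<le> \<tau> - \<epsilon> of (\<tau> - s) powr (- \<alpha> - 1) * (\<phi> \<tau> - \<phi> s)).

  This functional is monotone in the increments \<phi> \<tau> - \<phi> s, and Fubini's theorem rewrites it, for
  \<phi> = \<phi> 0 + c (integral of p), as c times an integral of p against an explicit nonnegative kernel
  that concentrates at \<tau> as \<epsilon> tends to 0 (\<open>marchaud_identity\<close>, \<open>marchaud_kernel_negative\<close>).
  Let w be the affine function on [0, T] falling from m + N to m, and let \<tau> be the first time at
  which V meets w. The increments of V at \<tau> dominate those of w, and those of 2 x \<tau> \<bullet> x _ dominate those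
  of V by the inequality 0 \<le> |x \<tau> - x s|^2. So the functional at 2 x \<tau> \<bullet> x _ is bounded below by
  its value at w, of order - N T powr - \<alpha>, and above by a fixed negative number coming from
  dissipativity. For large T this is absurd, hence V \<le> w (\<open>dissipative_decay\<close>). Letting the horizon
  T be the current time gives V \<le> m from some time on, and V \<le> m + N always.

  The same a priori bound makes g harmless outside a ball: it may be replaced there by a bounded,
  globally Lipschitz field, for which Banach's fixed point theorem in an exponentially weighted norm
  yields a unique global solution. This identifies the solution that the semiflow is built from
  (\<open>volterra_sol_const_path\<close>).

  For the Hoelder bound, split the history integral in T_t at the time T after which x stays in B*. The
  late part contributes at most G* / \<alpha> |\<theta>1 - \<theta>2| powr \<alpha>. The part before T has a smooth kernel, with
  Lipschitz constant of order (t - T) powr (\<alpha> - 1) in \<theta>, so for large t it is at most the same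
  amount, because G* > 0. The factor 2 in the definition of the set provides exactly this room
  (\<open>semiflow_const_path_in_B_zero\<close>).

  Precompactness is the theorem of Arzela and Ascoli on the intervals [0, i] together with a diagonal
  argument. The bounds defining the set survive pointwise limits, so the set is in fact compact
  (\<open>holder_bounded_compactin\<close>).
\<close>

section \<open>Weakly singular integrals\<close>

text \<open>
  Subadditivity: on [0, 1] a power with exponent at most 1 lies above the identity; apply this
  to the fractions x / (x + h) and h / (x + h).
\<close>
lemma powr_add_le_add_powr:
  fixes x h \<alpha> :: real
  assumes "0 < \<alpha>" "\<alpha> \<le> 1" "0 \<le> x" "0 \<le> h"
  shows "(x + h) powr \<alpha> \<le> x powr \<alpha> + h powr \<alpha>"
proof (cases "x + h = 0")
  case False
  then have pos: "x + h > 0" using assms by simp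
  have *: "u / (x + h) * (x + h) powr \<alpha> \<le> u powr \<alpha>" if "0 \<le> u" "u \<le> x + h" for u
  proof -
    have "(u / (x + h)) powr 1 \<le> (u / (x + h)) powr \<alpha>"
      using assms that pos by (intro powr_mono') auto
    then have "u / (x + h) \<le> u powr \<alpha> / (x + h) powr \<alpha>"
      using that pos by (simp add: powr_divide)
    then show ?thesis using pos by (simp add: field_simps)
  qed
  have "(x + h) powr \<alpha> = x / (x + h) * (x + h) powr \<alpha> + h / (x + h) * (x + h) powr \<alpha>"
    using pos by (simp add: distrib_right[symmetric] add_divide_distrib[symmetric])
  also have "\<dots> \<le> x powr \<alpha> + h powr \<alpha>"
    using assms by (intro add_mono *) auto
  finally show ?thesis .
qed (use assms in auto)

text \<open>
  The exponent \<open>\<beta>\<close> is kept general because the integrable kernel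
  (\<open>\<beta> = \<alpha>\<close>), the Marchaud kernel away from its singularity
  (\<open>\<beta> = - \<alpha>\<close>) and its first moment (\<open>\<beta> = 1 -
  \<alpha>\<close>) all occur below.
\<close>
lemma kernel_has_integral:
  fixes \<beta> t p q :: real
  assumes "\<beta> \<noteq> 0" "p \<le> q" "q < t \<or> 0 < \<beta> \<and> q \<le> t"
  shows "((\<lambda>s. (t - s) powr (\<beta> - 1)) has_integral ((t - p) powr \<beta> - (t - q) powr \<beta>) / \<beta>) {p..q}"
proof -
  have cont: "continuous_on {p..q} (\<lambda>s. - ((t - s) powr \<beta>) / \<beta>)"
  proof (cases "0 < \<beta>")
    case True
    then show ?thesis using assms by (intro continuous_intros continuous_on_powr') auto
  next
    case False
    then show ?thesis using assms by (intro continuous_intros) auto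
  qed
  have "((\<lambda>s. (t - s) powr (\<beta> - 1)) has_integral
      (- ((t - q) powr \<beta>) / \<beta> - - ((t - p) powr \<beta>) / \<beta>)) {p..q}"
  proof (rule fundamental_theorem_of_calculus_interior[OF \<open>p \<le> q\<close> cont])
    fix s assume "s \<in> {p<..<q}"
    then have "t - s > 0" using assms by auto
    then have "((\<lambda>s. - ((t - s) powr \<beta>) / \<beta>) has_real_derivative (t - s) powr (\<beta> - 1)) (at s)"
      using \<open>\<beta> \<noteq> 0\<close> by (auto intro!: derivative_eq_intros simp: powr_diff)
    then show "((\<lambda>s. - ((t - s) powr \<beta>) / \<beta>) has_vector_derivative (t - s) powr (\<beta> - 1)) (at s)"
      by (simp add: has_real_derivative_iff_has_vector_derivative)
  qed
  then show ?thesis by (simp add: diff_divide_distrib)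
qed

lemma kernel_scaleR_absolutely_integrable:
  fixes y :: "real \<Rightarrow> 'a::euclidean_space"
  assumes "\<beta> \<noteq> 0" "p \<le> q" "q < t \<or> 0 < \<beta> \<and> q \<le> t" "continuous_on {p..q} y"
  shows "(\<lambda>s. (t - s) powr (\<beta> - 1) *\<^sub>R y s) absolutely_integrable_on {p..q}"
proof -
  have "(\<lambda>s. (t - s) powr (\<beta> - 1)) absolutely_integrable_on {p..q}"
    using kernel_has_integral[OF assms(1-3)]
    by (intro nonnegative_absolutely_integrable_1) (auto simp: has_integral_iff)
  moreover have "bilinear (\<lambda>(v::'a) (r::real). r *\<^sub>R v)"
    by (auto simp: bilinear_def intro!: linearI simp: algebra_simps)
  moreover have "y \<in> borel_measurable (lebesgue_on {p..q})"
    using assms(4) by (intro continuous_imp_measurable_on_sets_lebesgue) auto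
  moreover have "bounded (y ` {p..q})"
    using assms(4) by (intro compact_imp_bounded compact_continuous_image) auto
  ultimately show ?thesis
    by (intro absolutely_integrable_bounded_measurable_product[where h="\<lambda>v r. r *\<^sub>R v"]) auto
qed

lemmas kernel_scaleR_integrable =
  set_lebesgue_integral_eq_integral(1)[OF kernel_scaleR_absolutely_integrable]

lemma norm_kernel_integral_le:
  fixes y :: "real \<Rightarrow> 'a::euclidean_space"
  assumes "\<beta> \<noteq> 0" "p \<le> q" "q < t \<or> 0 < \<beta> \<and> q \<le> t" "continuous_on {p..q} y"
    and "\<And>s. s \<in> {p..q} \<Longrightarrow> norm (y s) \<le> M"
  shows "norm (integral {p..q} (\<lambda>s. (t - s) powr (\<beta> - 1) *\<^sub>R y s))
    \<le> M * (((t - p) powr \<beta> - (t - q) powr \<beta>) / \<beta>)"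
proof -
  have I: "((\<lambda>s. M * (t - s) powr (\<beta> - 1)) has_integral
      M * (((t - p) powr \<beta> - (t - q) powr \<beta>) / \<beta>)) {p..q}"
    by (intro has_integral_mult_right kernel_has_integral assms)
  have "norm (integral {p..q} (\<lambda>s. (t - s) powr (\<beta> - 1) *\<^sub>R y s))
      \<le> integral {p..q} (\<lambda>s. M * (t - s) powr (\<beta> - 1))"
    using I assms(5)
    by (intro integral_norm_bound_integral kernel_scaleR_integrable assms(1-4))
       (auto simp: has_integral_iff mult.commute intro!: mult_right_mono)
  then show ?thesis using I by (simp add: has_integral_iff)
qed

text \<open>
  The kernel decreases in its upper argument, so the absolute value of the difference of the two
  kernels can be integrated exactly.
\<close>
lemma norm_kernel_integral_diff_le:
  fixes y :: "real \<Rightarrow> 'a::euclidean_space"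
  assumes "0 < \<alpha>" "\<alpha> < 1" "p \<le> q" "q \<le> t1" "t1 \<le> t2" "continuous_on {p..q} y"
    and M: "\<And>s. s \<in> {p..q} \<Longrightarrow> norm (y s) \<le> M"
  shows "norm (integral {p..q} (\<lambda>s. (t2 - s) powr (\<alpha> - 1) *\<^sub>R y s)
      - integral {p..q} (\<lambda>s. (t1 - s) powr (\<alpha> - 1) *\<^sub>R y s))
    \<le> M / \<alpha> * (((t1 - p) powr \<alpha> - (t1 - q) powr \<alpha>) - ((t2 - p) powr \<alpha> - (t2 - q) powr \<alpha>))"
proof -
  let ?k = "\<lambda>t s. (t - s) powr (\<alpha> - 1)"
  \<comment> \<open>At s = t1 the first kernel is 0 powr (\<alpha> - 1) = 0, so the pointwise bound fails
    there; the majorant is corrected at this one point.\<close>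
  define D where "D = (\<lambda>s. if s = t1 then norm ((?k t2 s - ?k t1 s) *\<^sub>R y s) else M * (?k t1 s - ?k t2 s))"
  have "((\<lambda>s. M * (?k t1 s - ?k t2 s)) has_integral
      M * (((t1 - p) powr \<alpha> - (t1 - q) powr \<alpha>) / \<alpha> - ((t2 - p) powr \<alpha> - (t2 - q) powr \<alpha>) / \<alpha>)) {p..q}"
    using assms by (intro has_integral_mult_right has_integral_diff kernel_has_integral) auto
  then have ID: "(D has_integral
      M * (((t1 - p) powr \<alpha> - (t1 - q) powr \<alpha>) / \<alpha> - ((t2 - p) powr \<alpha> - (t2 - q) powr \<alpha>) / \<alpha>)) {p..q}"
    by (rule has_integral_spike_finite[of "{t1}", rotated 2]) (auto simp: D_def)
  have int: "(\<lambda>s. ?k t s *\<^sub>R y s) integrable_on {p..q}" if "q \<le> t" for t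
    using assms that by (intro kernel_scaleR_integrable) auto
  have "norm (integral {p..q} (\<lambda>s. (?k t2 s - ?k t1 s) *\<^sub>R y s)) \<le> integral {p..q} D"
  proof (rule integral_norm_bound_integral)
    show "(\<lambda>s. (?k t2 s - ?k t1 s) *\<^sub>R y s) integrable_on {p..q}"
      unfolding scaleR_left_diff_distrib using assms by (intro integrable_diff int) auto
    show "D integrable_on {p..q}" using ID by blast
    show "norm ((?k t2 s - ?k t1 s) *\<^sub>R y s) \<le> D s" if s: "s \<in> {p..q}" for s
    proof (cases "s = t1")
      case False
      then have "s < t1" using s assms by auto
      then have "?k t2 s \<le> ?k t1 s"
        using assms by (intro powr_mono2') auto
      then have "norm ((?k t2 s - ?k t1 s) *\<^sub>R y s) = norm (y s) * (?k t1 s - ?k t2 s)"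
        by (simp add: abs_if)
      also have "\<dots> \<le> D s"
        using False \<open>?k t2 s \<le> ?k t1 s\<close> M[OF s] unfolding D_def by (auto intro: mult_right_mono)
      finally show ?thesis .
    qed (simp add: D_def)
  qed
  moreover have "integral {p..q} (\<lambda>s. (?k t2 s - ?k t1 s) *\<^sub>R y s)
      = integral {p..q} (\<lambda>s. ?k t2 s *\<^sub>R y s) - integral {p..q} (\<lambda>s. ?k t1 s *\<^sub>R y s)"
    unfolding scaleR_left_diff_distrib using assms by (intro integral_diff int) auto
  moreover have "integral {p..q} D = M / \<alpha> * (((t1 - p) powr \<alpha> - (t1 - q) powr \<alpha>) - ((t2 - p) powr \<alpha> - (t2 - q) powr \<alpha>))"
    using ID by (simp add: has_integral_iff diff_divide_distrib right_diff_distrib)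
  ultimately show ?thesis by simp
qed

lemma norm_kernel_integral_diff_le_powr:
  fixes y :: "real \<Rightarrow> 'a::euclidean_space"
  assumes "0 < \<alpha>" "\<alpha> < 1" "p \<le> q" "q \<le> t1" "t1 \<le> t2" "continuous_on {p..q} y"
    and M: "\<And>s. s \<in> {p..q} \<Longrightarrow> norm (y s) \<le> M"
  shows "norm (integral {p..q} (\<lambda>s. (t2 - s) powr (\<alpha> - 1) *\<^sub>R y s)
      - integral {p..q} (\<lambda>s. (t1 - s) powr (\<alpha> - 1) *\<^sub>R y s)) \<le> M / \<alpha> * (t2 - t1) powr \<alpha>"
proof -
  have "0 \<le> M" using order_trans[OF norm_ge_zero M[of p]] assms(3) by simp
  have "(t2 - q) powr \<alpha> \<le> (t1 - q) powr \<alpha> + (t2 - t1) powr \<alpha>"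
    using powr_add_le_add_powr[of \<alpha> "t1 - q" "t2 - t1"] assms by simp
  moreover have "(t1 - p) powr \<alpha> \<le> (t2 - p) powr \<alpha>"
    using assms by (intro powr_mono2) auto
  ultimately have "((t1 - p) powr \<alpha> - (t1 - q) powr \<alpha>) - ((t2 - p) powr \<alpha> - (t2 - q) powr \<alpha>) \<le> (t2 - t1) powr \<alpha>"
    by simp
  then show ?thesis
    using \<open>0 \<le> M\<close> \<open>0 < \<alpha>\<close> by (intro order_trans[OF norm_kernel_integral_diff_le[OF assms]] mult_left_mono) auto
qed

definition abel_integral :: "real \<Rightarrow> (real \<Rightarrow> 'a::euclidean_space) \<Rightarrow> real \<Rightarrow> 'a" where
  "abel_integral \<alpha> y t = integral {0..t} (\<lambda>s. (t - s) powr (\<alpha> - 1) *\<^sub>R y s)"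

text \<open>
  The increment splits into the change of the kernel on the common interval and the new piece;
  each is at most M / \<alpha> times the power of the increment.
\<close>
lemma abel_integral_holder:
  fixes y :: "real \<Rightarrow> 'a::euclidean_space"
  assumes "0 < \<alpha>" "\<alpha> < 1" "0 \<le> t1" "t1 \<le> t2" "continuous_on {0..t2} y"
    and M: "\<And>s. s \<in> {0..t2} \<Longrightarrow> norm (y s) \<le> M"
  shows "norm (abel_integral \<alpha> y t2 - abel_integral \<alpha> y t1) \<le> 2 * M / \<alpha> * (t2 - t1) powr \<alpha>"
proof -
  let ?k = "\<lambda>t s. (t - s) powr (\<alpha> - 1) *\<^sub>R y s"
  have c: "continuous_on {0..t1} y" "continuous_on {t1..t2} y"
    using assms by (auto intro: continuous_on_subset)
  have "?k t2 integrable_on {0..t2}"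
    using assms by (intro kernel_scaleR_integrable) auto
  then have "abel_integral \<alpha> y t2 = integral {0..t1} (?k t2) + integral {t1..t2} (?k t2)"
    unfolding abel_integral_def using assms by (intro Henstock_Kurzweil_Integration.integral_combine[symmetric]) auto
  then have "norm (abel_integral \<alpha> y t2 - abel_integral \<alpha> y t1)
      \<le> norm (integral {0..t1} (?k t2) - integral {0..t1} (?k t1)) + norm (integral {t1..t2} (?k t2))"
    unfolding abel_integral_def
    using norm_triangle_ineq[of "integral {0..t1} (?k t2) - integral {0..t1} (?k t1)" "integral {t1..t2} (?k t2)"]
    by (simp add: algebra_simps)
  also have "\<dots> \<le> M / \<alpha> * (t2 - t1) powr \<alpha> + M * (((t2 - t1) powr \<alpha> - (t2 - t2) powr \<alpha>) / \<alpha>)"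
    using assms c by (intro add_mono norm_kernel_integral_diff_le_powr norm_kernel_integral_le) auto
  finally show ?thesis by simp
qed

lemma holder_continuous_on:
  fixes f :: "real \<Rightarrow> 'a::real_normed_vector"
  assumes "0 < \<alpha>" and hol: "\<And>u v. u \<in> A \<Longrightarrow> v \<in> A \<Longrightarrow> norm (f u - f v) \<le> C * \<bar>u - v\<bar> powr \<alpha>"
  shows "continuous_on A f"
  unfolding continuous_on_def
proof
  fix v assume v: "v \<in> A"
  have "((\<lambda>u. C * \<bar>u - v\<bar> powr \<alpha>) \<longlongrightarrow> C * \<bar>v - v\<bar> powr \<alpha>) (at v within A)"
    using assms(1) by (intro tendsto_intros) auto
  then have "((\<lambda>u. C * \<bar>u - v\<bar> powr \<alpha>) \<longlongrightarrow> 0) (at v within A)"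
    by simp
  then have "((\<lambda>u. f u - f v) \<longlongrightarrow> 0) (at v within A)"
    by (rule Lim_null_comparison[rotated]) (use hol v in \<open>auto simp: eventually_at_filter\<close>)
  then show "(f \<longlongrightarrow> f v) (at v within A)"
    using Lim_null by blast
qed

lemma abel_integral_continuous_on:
  fixes y :: "real \<Rightarrow> 'a::euclidean_space"
  assumes "0 < \<alpha>" "\<alpha> < 1" "continuous_on {0..} y"
  shows "continuous_on {0..} (abel_integral \<alpha> y)"
proof -
  have *: "continuous_on {0..N} (abel_integral \<alpha> y)" if "0 < N" for N
  proof -
    have cN: "continuous_on {0..N} y" using assms by (auto intro: continuous_on_subset)
    then have "bounded (y ` {0..N})"
      by (intro compact_imp_bounded compact_continuous_image) auto
    then obtain M where M: "\<And>s. s \<in> {0..N} \<Longrightarrow> norm (y s) \<le> M"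
      unfolding bounded_iff by (auto simp del: atLeastAtMost_iff)
    have hol: "norm (abel_integral \<alpha> y u - abel_integral \<alpha> y v) \<le> 2 * M / \<alpha> * \<bar>u - v\<bar> powr \<alpha>"
      if "u \<in> {0..N}" "v \<in> {0..N}" for u v
    proof (cases "v \<le> u")
      case True
      then show ?thesis
        using abel_integral_holder[of \<alpha> v u y M] assms that M continuous_on_subset[OF cN, of "{0..u}"] by auto
    next
      case False
      then show ?thesis
        using abel_integral_holder[of \<alpha> u v y M] assms that M continuous_on_subset[OF cN, of "{0..v}"]
        by (auto simp: norm_minus_commute)
    qed
    show ?thesis using assms(1) hol by (rule holder_continuous_on)
  qed
  show ?thesis
    unfolding continuous_on_eq_continuous_within
  proof
    fix t :: real assume t: "t \<in> {0..}"
    have "continuous (at t within {0..t+1}) (abel_integral \<alpha> y)"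
      using *[of "t+1"] t by (simp add: continuous_on_eq_continuous_within)
    moreover have "at t within {0..t+1} = at t within {0..}"
      by (rule at_within_nhd[of t "{..<t+1}"]) auto
    ultimately show "continuous (at t within {0..}) (abel_integral \<alpha> y)"
      by (simp add: continuous_within)
  qed
qed

section \<open>The Marchaud form of the fractional integral equation\<close>

text \<open>
  An incomplete Beta integral with an elementary primitive: the power of (s - \<sigma>) /
  (\<tau> - s) with exponent \<alpha>, up to a constant factor. This is why the exponents -
  \<alpha> - 1 and \<alpha> - 1 fit together.
\<close>
lemma beta_kernel_has_integral:
  fixes \<alpha> \<tau> \<epsilon> \<sigma> :: real
  assumes "0 < \<alpha>" "0 < \<epsilon>" "\<sigma> \<le> \<tau> - \<epsilon>"
  shows "((\<lambda>s. (\<tau> - s) powr (- \<alpha> - 1) * (s - \<sigma>) powr (\<alpha> - 1)) has_integral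
      ((\<tau> - \<epsilon> - \<sigma>) / \<epsilon>) powr \<alpha> / (\<alpha> * (\<tau> - \<sigma>))) {\<sigma>..\<tau> - \<epsilon>}"
proof -
  let ?F = "\<lambda>s. ((s - \<sigma>) / (\<tau> - s)) powr \<alpha> / (\<alpha> * (\<tau> - \<sigma>))"
  have "((\<lambda>s. (\<tau> - s) powr (- \<alpha> - 1) * (s - \<sigma>) powr (\<alpha> - 1)) has_integral
      (?F (\<tau> - \<epsilon>) - ?F \<sigma>)) {\<sigma>..\<tau> - \<epsilon>}"
  proof (rule fundamental_theorem_of_calculus_interior)
    show "continuous_on {\<sigma>..\<tau> - \<epsilon>} ?F"
      using assms by (intro continuous_intros continuous_on_powr') auto
    fix s assume s: "s \<in> {\<sigma><..<\<tau> - \<epsilon>}"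
    define r where "r = \<tau> - s"
    define q where "q = s - \<sigma>"
    have pos: "r > 0" "q > 0" using s assms by (auto simp: r_def q_def)
    have rq: "\<tau> - \<sigma> = r + q" by (simp add: r_def q_def)
    have d1: "((\<lambda>s. (s - \<sigma>) / (\<tau> - s)) has_real_derivative (r + q) / r\<^sup>2) (at s)"
      using pos unfolding r_def q_def
      by (auto intro!: derivative_eq_intros simp: power2_eq_square)
    have "(?F has_real_derivative (\<alpha> * (q / r) powr (\<alpha> - 1) * ((r + q) / r\<^sup>2)) / (\<alpha> * (r + q))) (at s)"
      unfolding rq using DERIV_fun_powr[OF d1, of \<alpha>] pos
      by (intro DERIV_cdivide) (simp add: r_def q_def)
    also have "(\<alpha> * (q / r) powr (\<alpha> - 1) * ((r + q) / r\<^sup>2)) / (\<alpha> * (r + q)) = r powr (- \<alpha> - 1) * q powr (\<alpha> - 1)"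
    proof -
      have "r powr (- \<alpha> - 1) = 1 / (r powr (\<alpha> - 1) * r\<^sup>2)"
        using pos by (simp add: powr_minus powr_diff powr_add divide_simps power2_eq_square)
      then show ?thesis
        using pos assms by (simp add: powr_divide divide_simps)
    qed
    finally show "(?F has_vector_derivative (\<tau> - s) powr (- \<alpha> - 1) * (s - \<sigma>) powr (\<alpha> - 1)) (at s)"
      unfolding r_def q_def by (simp add: has_real_derivative_iff_has_vector_derivative)
  qed (use assms in auto)
  then show ?thesis using assms by simp
qed

text \<open>
  Bridge from gauge integrals over a set to Lebesgue integrals over the line, where Fubini's
  theorem lives.
\<close>
lemma lborel_integral_eq_integral:
  fixes f h :: "real \<Rightarrow> real"
  assumes h: "h \<in> borel_measurable borel" and f: "f absolutely_integrable_on S"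
    and eq: "\<And>x. h x = (if x \<in> S then f x else 0)"
  shows "integrable lborel h" "integral\<^sup>L lborel h = integral S f"
proof -
  have "h = (\<lambda>x. indicat_real S x *\<^sub>R f x)" using eq by (auto simp: fun_eq_iff)
  then have "integrable lebesgue h" using f by (simp add: set_integrable_def)
  then show int: "integrable lborel h"
    using h by (simp add: integrable_completion)
  have "h = (\<lambda>x. if x \<in> S then f x else 0)" using eq by (auto simp: fun_eq_iff)
  then show "integral\<^sup>L lborel h = integral S f"
    using integral_lborel[OF int] by (simp add: integral_restrict_UNIV)
qed

text \<open>
  Fubini's theorem on the triangle 0 \<le> \<sigma> \<le> s \<le> \<tau> - \<epsilon>. The
  factor (\<tau> - s) powr (- \<alpha> - 1) is bounded there because \<epsilon> > 0, so absolute
  integrability reduces to that of the kernel (s - \<sigma>) powr (\<alpha> - 1).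
\<close>
lemma abel_integral_swap:
  fixes p :: "real \<Rightarrow> real"
  assumes "0 < \<alpha>" "\<alpha> < 1" "0 < \<epsilon>" "\<epsilon> < \<tau>" "continuous_on UNIV p"
  shows "integral {0..\<tau> - \<epsilon>} (\<lambda>s. (\<tau> - s) powr (- \<alpha> - 1) * abel_integral \<alpha> p s)
    = integral {0..\<tau> - \<epsilon>} (\<lambda>\<sigma>. ((\<tau> - \<epsilon> - \<sigma>) / \<epsilon>) powr \<alpha> / (\<alpha> * (\<tau> - \<sigma>)) * p \<sigma>)"
proof -
  define b where "b = \<tau> - \<epsilon>"
  have b: "0 < b" "b < \<tau>" using assms by (auto simp: b_def)
  have [measurable]: "p \<in> borel_measurable borel" using assms(5) by (rule borel_measurable_continuous_onI)
  define H where "H = (\<lambda>s \<sigma>. if 0 \<le> \<sigma> \<and> \<sigma> \<le> s \<and> s \<le> b then (s - \<sigma>) powr (\<alpha> - 1) else 0)"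
  define F where "F = (\<lambda>s \<sigma>. H s \<sigma> * ((\<tau> - s) powr (- \<alpha> - 1) * p \<sigma>))"
  have Hm[measurable]: "case_prod H \<in> borel_measurable (lborel \<Otimes>\<^sub>M lborel)"
    unfolding H_def by measurable
  have Fm[measurable]: "case_prod F \<in> borel_measurable (lborel \<Otimes>\<^sub>M lborel)"
    unfolding F_def H_def by measurable
  have Hs: "integrable lborel (H s)"
      "integral\<^sup>L lborel (H s) = (if s \<in> {0..b} then s powr \<alpha> / \<alpha> else 0)" for s
  proof -
    have "integrable lborel (H s) \<and> integral\<^sup>L lborel (H s) = (if s \<in> {0..b} then s powr \<alpha> / \<alpha> else 0)"
    proof (cases "s \<in> {0..b}")
      case True
      have I: "((\<lambda>\<sigma>. (s - \<sigma>) powr (\<alpha> - 1)) has_integral ((s - 0) powr \<alpha> - (s - s) powr \<alpha>) / \<alpha>) {0..s}"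
        using True assms by (intro kernel_has_integral) auto
      have *: "(\<lambda>\<sigma>. (s - \<sigma>) powr (\<alpha> - 1)) absolutely_integrable_on {0..s}"
        using I by (intro nonnegative_absolutely_integrable_1) (auto simp: has_integral_iff)
      have m: "H s \<in> borel_measurable borel" unfolding H_def by measurable
      have eq: "H s x = (if x \<in> {0..s} then (s - x) powr (\<alpha> - 1) else 0)" for x
        using True by (auto simp: H_def)
      from lborel_integral_eq_integral[OF m * eq] I True show ?thesis
        by (auto simp: has_integral_iff)
    next
      case False
      then have "H s = (\<lambda>_. 0)" by (auto simp: H_def fun_eq_iff)
      with False show ?thesis by auto
    qed
    then show "integrable lborel (H s)"
      "integral\<^sup>L lborel (H s) = (if s \<in> {0..b} then s powr \<alpha> / \<alpha> else 0)" by auto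
  qed
  \<comment> \<open>The inner integral of the kernel is s powr \<alpha> / \<alpha>, which is continuous, so
    Tonelli applies to the positive kernel; then p is brought in by domination.\<close>
  have intH: "integrable (lborel \<Otimes>\<^sub>M lborel) (case_prod H)"
  proof (rule lborel_pair.Fubini_integrable[OF Hm])
    have "continuous_on {0..b} (\<lambda>s. s powr \<alpha> / \<alpha>)"
      using assms by (intro continuous_intros continuous_on_powr') auto
    then have "(\<lambda>s. s powr \<alpha> / \<alpha>) absolutely_integrable_on {0..b}"
      by (rule absolutely_integrable_continuous_real)
    then have "integrable lborel (\<lambda>s. if s \<in> {0..b} then s powr \<alpha> / \<alpha> else 0)"
      by (intro lborel_integral_eq_integral(1)[where S="{0..b}"]) auto
    moreover have "norm (H s \<sigma>) = H s \<sigma>" for s \<sigma> by (auto simp: H_def)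
    ultimately show "integrable lborel (\<lambda>x. \<integral>y. norm (case (x, y) of (x, y) \<Rightarrow> H x y) \<partial>lborel)"
      by (simp add: Hs(2))
    show "AE x in lborel. integrable lborel (\<lambda>y. case (x, y) of (x, y) \<Rightarrow> H x y)"
      using Hs(1) by simp
  qed
  have "bounded (p ` {0..b})"
    using assms(5) by (intro compact_imp_bounded compact_continuous_image) (auto intro: continuous_on_subset)
  then obtain Q where Q: "\<And>s. s \<in> {0..b} \<Longrightarrow> \<bar>p s\<bar> \<le> Q"
    unfolding bounded_iff by (auto simp del: atLeastAtMost_iff)
  have "Q \<ge> 0" using Q[of 0] b by auto
  have intF: "integrable (lborel \<Otimes>\<^sub>M lborel) (case_prod F)"
  proof (rule Bochner_Integration.integrable_bound[OF integrable_mult_right[OF intH, of "\<epsilon> powr (- \<alpha> - 1) * Q"] Fm])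
    have "\<bar>F s \<sigma>\<bar> \<le> \<bar>\<epsilon> powr (- \<alpha> - 1) * Q * H s \<sigma>\<bar>" for s \<sigma>
    proof (cases "0 \<le> \<sigma> \<and> \<sigma> \<le> s \<and> s \<le> b")
      case True
      then have "(\<tau> - s) powr (- \<alpha> - 1) \<le> \<epsilon> powr (- \<alpha> - 1)"
        using assms by (intro powr_mono2') (auto simp: b_def)
      moreover have "\<bar>p \<sigma>\<bar> \<le> Q" using Q True by auto
      ultimately have "(\<tau> - s) powr (- \<alpha> - 1) * \<bar>p \<sigma>\<bar> \<le> \<epsilon> powr (- \<alpha> - 1) * Q"
        by (intro mult_mono) auto
      then show ?thesis
        using \<open>Q \<ge> 0\<close> unfolding F_def
        by (simp add: abs_mult mult.commute mult_left_mono)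
    qed (auto simp: F_def H_def)
    then show "AE x in lborel \<Otimes>\<^sub>M lborel. norm (case_prod F x) \<le> norm (\<epsilon> powr (- \<alpha> - 1) * Q * case_prod H x)"
      by auto
  qed
  have L: "(\<integral>\<sigma>. F s \<sigma> \<partial>lborel) = (if s \<in> {0..b} then (\<tau> - s) powr (- \<alpha> - 1) * abel_integral \<alpha> p s else 0)" for s
  proof (cases "s \<in> {0..b}")
    case True
    have "(\<lambda>\<sigma>. (s - \<sigma>) powr (\<alpha> - 1) *\<^sub>R p \<sigma>) absolutely_integrable_on {0..s}"
      using True assms by (intro kernel_scaleR_absolutely_integrable) (auto intro: continuous_on_subset)
    then have "(\<integral>\<sigma>. H s \<sigma> * p \<sigma> \<partial>lborel) = abel_integral \<alpha> p s"
      unfolding abel_integral_def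
      using True by (intro lborel_integral_eq_integral(2)) (auto simp: H_def)
    moreover have "F s = (\<lambda>\<sigma>. (\<tau> - s) powr (- \<alpha> - 1) * (H s \<sigma> * p \<sigma>))"
      by (auto simp: F_def fun_eq_iff)
    ultimately show ?thesis using True by simp
  next
    case False
    then have "F s = (\<lambda>_. 0)" by (auto simp: F_def H_def fun_eq_iff)
    with False show ?thesis by auto
  qed
  have R: "(\<integral>s. F s \<sigma> \<partial>lborel) = (if \<sigma> \<in> {0..b} then ((b - \<sigma>) / \<epsilon>) powr \<alpha> / (\<alpha> * (\<tau> - \<sigma>)) * p \<sigma> else 0)" for \<sigma>
  proof (cases "\<sigma> \<in> {0..b}")
    case True
    have I: "((\<lambda>s. (\<tau> - s) powr (- \<alpha> - 1) * (s - \<sigma>) powr (\<alpha> - 1)) has_integral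
      ((b - \<sigma>) / \<epsilon>) powr \<alpha> / (\<alpha> * (\<tau> - \<sigma>))) {\<sigma>..b}"
      using beta_kernel_has_integral[of \<alpha> \<epsilon> \<sigma> \<tau>] assms True by (auto simp: b_def)
    then have "(\<lambda>s. (\<tau> - s) powr (- \<alpha> - 1) * (s - \<sigma>) powr (\<alpha> - 1)) absolutely_integrable_on {\<sigma>..b}"
      by (intro nonnegative_absolutely_integrable_1) (auto simp: has_integral_iff)
    then have "(\<integral>s. (if s \<in> {\<sigma>..b} then (\<tau> - s) powr (- \<alpha> - 1) * (s - \<sigma>) powr (\<alpha> - 1) else 0) \<partial>lborel)
        = integral {\<sigma>..b} (\<lambda>s. (\<tau> - s) powr (- \<alpha> - 1) * (s - \<sigma>) powr (\<alpha> - 1))"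
      by (intro lborel_integral_eq_integral(2)) auto
    also have "\<dots> = ((b - \<sigma>) / \<epsilon>) powr \<alpha> / (\<alpha> * (\<tau> - \<sigma>))"
      using I by (simp add: has_integral_iff)
    finally have "(\<integral>s. (if s \<in> {\<sigma>..b} then (\<tau> - s) powr (- \<alpha> - 1) * (s - \<sigma>) powr (\<alpha> - 1) else 0) \<partial>lborel)
        = ((b - \<sigma>) / \<epsilon>) powr \<alpha> / (\<alpha> * (\<tau> - \<sigma>))" .
    moreover have "(\<lambda>s. F s \<sigma>) = (\<lambda>s. (if s \<in> {\<sigma>..b} then (\<tau> - s) powr (- \<alpha> - 1) * (s - \<sigma>) powr (\<alpha> - 1) else 0) * p \<sigma>)"
      using True by (auto simp: F_def H_def fun_eq_iff)
    ultimately show ?thesis using True by simp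
  next
    case False
    then have "(\<lambda>s. F s \<sigma>) = (\<lambda>_. 0)" by (auto simp: F_def H_def fun_eq_iff)
    with False show ?thesis by auto
  qed
  have "integral {0..b} (\<lambda>s. (\<tau> - s) powr (- \<alpha> - 1) * abel_integral \<alpha> p s) = (\<integral>s. (\<integral>\<sigma>. F s \<sigma> \<partial>lborel) \<partial>lborel)"
    using integral_lborel[OF lborel_pair.integrable_fst'[OF intF]]
    by (simp add: L integral_restrict_UNIV del: atLeastAtMost_iff)
  also have "\<dots> = (\<integral>\<sigma>. (\<integral>s. F s \<sigma> \<partial>lborel) \<partial>lborel)"
    using lborel_pair.Fubini_integral[OF intF] by simp
  also have "\<dots> = integral {0..b} (\<lambda>\<sigma>. ((b - \<sigma>) / \<epsilon>) powr \<alpha> / (\<alpha> * (\<tau> - \<sigma>)) * p \<sigma>)"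
    using integral_lborel[OF lborel_pair.integrable_snd[OF intF]]
    by (simp add: R integral_restrict_UNIV del: atLeastAtMost_iff)
  finally show ?thesis by (simp add: b_def)
qed

text \<open>
  The left-hand side is \<Gamma> (1 - \<alpha>) times the truncated Marchaud derivative of
  \<phi>. As \<epsilon> tends to 0 the right-hand side tends to a positive multiple of p \<tau>,
  but keeping \<epsilon> > 0 avoids all questions of differentiability: only the sign and the
  concentration of the kernel on the right are needed.
\<close>
lemma marchaud_identity:
  fixes p \<phi> :: "real \<Rightarrow> real"
  assumes "0 < \<alpha>" "\<alpha> < 1" "0 < \<epsilon>" "\<epsilon> < \<tau>" "continuous_on {0..\<tau>} p"
    and \<phi>: "\<And>s. s \<in> {0..\<tau>} \<Longrightarrow> \<phi> s = \<phi>0 + c * abel_integral \<alpha> p s"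
    and cont: "continuous_on {0..\<tau>} \<phi>"
  shows "\<tau> powr (- \<alpha>) * (\<phi> \<tau> - \<phi> 0) + \<alpha> * integral {0..\<tau> - \<epsilon>} (\<lambda>s. (\<tau> - s) powr (- \<alpha> - 1) * (\<phi> \<tau> - \<phi> s))
    = c * \<epsilon> powr (- \<alpha>) * (integral {0..\<tau> - \<epsilon>} (\<lambda>\<sigma>. ((\<tau> - \<sigma>) powr \<alpha> - (\<tau> - \<epsilon> - \<sigma>) powr \<alpha>) / (\<tau> - \<sigma>) * p \<sigma>)
        + integral {\<tau> - \<epsilon>..\<tau>} (\<lambda>\<sigma>. (\<tau> - \<sigma>) powr (\<alpha> - 1) * p \<sigma>))"
proof -
  define b where "b = \<tau> - \<epsilon>"
  have b: "0 < b" "b < \<tau>" "\<epsilon> = \<tau> - b" using assms by (auto simp: b_def)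
  let ?k = "\<lambda>s. (\<tau> - s) powr (- \<alpha> - 1)"
  define A where "A = abel_integral \<alpha> p"
  define J where "J = integral {0..b} (\<lambda>s. ?k s * A s)"
  have A0: "A 0 = 0" by (simp add: A_def abel_integral_def)
  have kint: "(?k has_integral (\<tau> powr (- \<alpha>) - \<epsilon> powr (- \<alpha>)) / (- \<alpha>)) {0..b}"
    using kernel_has_integral[of "- \<alpha>" 0 b \<tau>] assms b by simp
  \<comment> \<open>A continuous extension of p to the line is Borel measurable, as Fubini requires.\<close>
  define p' where "p' = (\<lambda>s. p (max 0 (min \<tau> s)))"
  have p'c: "continuous_on UNIV p'" unfolding p'_def
    by (rule continuous_on_compose2[OF assms(5)]) (use assms in \<open>auto intro!: continuous_intros\<close>)
  have p'eq: "p' s = p s" if "s \<in> {0..\<tau>}" for s using that by (auto simp: p'_def min_def max_def)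
  have Aeq: "abel_integral \<alpha> p' s = A s" if "s \<in> {0..b}" for s
    unfolding A_def abel_integral_def
    by (intro integral_cong) (use that b p'eq in auto)
  have J: "J = integral {0..b} (\<lambda>\<sigma>. ((b - \<sigma>) / \<epsilon>) powr \<alpha> / (\<alpha> * (\<tau> - \<sigma>)) * p \<sigma>)"
  proof -
    have "J = integral {0..b} (\<lambda>s. ?k s * abel_integral \<alpha> p' s)"
      unfolding J_def by (intro integral_cong) (use Aeq in auto)
    also have "\<dots> = integral {0..b} (\<lambda>\<sigma>. ((b - \<sigma>) / \<epsilon>) powr \<alpha> / (\<alpha> * (\<tau> - \<sigma>)) * p' \<sigma>)"
      unfolding b_def by (rule abel_integral_swap) (use assms p'c in auto)
    also have "\<dots> = integral {0..b} (\<lambda>\<sigma>. ((b - \<sigma>) / \<epsilon>) powr \<alpha> / (\<alpha> * (\<tau> - \<sigma>)) * p \<sigma>)"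
      by (intro integral_cong) (use p'eq b in auto)
    finally show ?thesis .
  qed
  define I1 where "I1 = integral {0..b} (\<lambda>s. ?k s * (\<phi> \<tau> - \<phi> s))"
  define I2 where "I2 = integral {0..b} (\<lambda>s. ?k s * (\<phi> s - \<phi> 0))"
  define E where "E = \<epsilon> powr (- \<alpha>) - \<tau> powr (- \<alpha>)"
  have cJ: "c * J = I2"
    unfolding J_def I2_def integral_mult_right[symmetric]
    by (intro integral_cong) (use \<phi>[of 0] \<phi> b assms A0 in \<open>auto simp: A_def algebra_simps\<close>)
  have "I1 + I2
      = integral {0..b} (\<lambda>s. ?k s * (\<phi> \<tau> - \<phi> 0))"
    unfolding I1_def I2_def
  proof (subst integral_add[symmetric])
    have c: "continuous_on {0..b} \<phi>" using cont by (rule continuous_on_subset) (use b in auto)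
    show "(\<lambda>s. ?k s * (\<phi> \<tau> - \<phi> s)) integrable_on {0..b}" "(\<lambda>s. ?k s * (\<phi> s - \<phi> 0)) integrable_on {0..b}"
      using b by (auto intro!: integrable_continuous_interval continuous_intros c)
  qed (simp add: algebra_simps)
  also have "\<dots> = E / \<alpha> * (\<phi> \<tau> - \<phi> 0)"
    using kint assms by (simp add: integral_mult_left has_integral_iff divide_simps E_def)
  finally have "\<alpha> * I1 = E * (\<phi> \<tau> - \<phi> 0) - \<alpha> * (c * J)"
    using assms(1) unfolding cJ by (simp add: field_simps)
  moreover have "\<phi> \<tau> - \<phi> 0 = c * A \<tau>" using \<phi>[of \<tau>] \<phi>[of 0] assms A0 by (simp add: A_def)
  ultimately have lhs: "\<tau> powr (- \<alpha>) * (\<phi> \<tau> - \<phi> 0) + \<alpha> * I1 = c * (\<epsilon> powr (- \<alpha>) * A \<tau> - \<alpha> * J)"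
    by (simp add: E_def algebra_simps)
  let ?k1 = "\<lambda>\<sigma>. (\<tau> - \<sigma>) powr (\<alpha> - 1) * p \<sigma>"
  have "A \<tau> = integral {0..b} ?k1 + integral {b..\<tau>} ?k1"
    unfolding A_def abel_integral_def real_scaleR_def
    using kernel_scaleR_integrable[of \<alpha> 0 \<tau> \<tau> p] assms b
    by (intro Henstock_Kurzweil_Integration.integral_combine[symmetric]) auto
  moreover have "\<epsilon> powr (- \<alpha>) * integral {0..b} ?k1 - \<alpha> * J
      = \<epsilon> powr (- \<alpha>) * integral {0..b} (\<lambda>\<sigma>. ((\<tau> - \<sigma>) powr \<alpha> - (b - \<sigma>) powr \<alpha>) / (\<tau> - \<sigma>) * p \<sigma>)"
  proof -
    have c: "continuous_on {0..b} p" using assms(5) by (rule continuous_on_subset) (use b in auto)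
    have i1: "?k1 integrable_on {0..b}"
      using b by (auto intro!: integrable_continuous_interval continuous_intros c)
    have i2: "(\<lambda>\<sigma>. ((b - \<sigma>) / \<epsilon>) powr \<alpha> / (\<alpha> * (\<tau> - \<sigma>)) * p \<sigma>) integrable_on {0..b}"
      using b assms(1,3) by (auto intro!: integrable_continuous_interval continuous_intros continuous_on_powr' c)
    have "\<epsilon> powr (- \<alpha>) * integral {0..b} ?k1 - \<alpha> * J
      = integral {0..b} (\<lambda>\<sigma>. \<epsilon> powr (- \<alpha>) * ?k1 \<sigma> - \<alpha> * (((b - \<sigma>) / \<epsilon>) powr \<alpha> / (\<alpha> * (\<tau> - \<sigma>)) * p \<sigma>))"
      unfolding J integral_mult_right[symmetric]
      by (intro integral_diff[symmetric] integrable_on_mult_right i1 i2)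
    also have "\<dots> = integral {0..b} (\<lambda>\<sigma>. \<epsilon> powr (- \<alpha>) * (((\<tau> - \<sigma>) powr \<alpha> - (b - \<sigma>) powr \<alpha>) / (\<tau> - \<sigma>) * p \<sigma>))"
    proof (rule integral_cong)
      fix \<sigma> assume s: "\<sigma> \<in> {0..b}"
      have e1: "((b - \<sigma>) / \<epsilon>) powr \<alpha> = (b - \<sigma>) powr \<alpha> * \<epsilon> powr (- \<alpha>)"
        using s assms(3) by (simp add: powr_divide powr_minus field_simps)
      have e2: "(\<tau> - \<sigma>) powr (\<alpha> - 1) = (\<tau> - \<sigma>) powr \<alpha> / (\<tau> - \<sigma>)"
        using s b by (simp add: powr_diff)
      have "E * (A / d * P) - \<alpha> * (B * E / (\<alpha> * d) * P) = E * ((A - B) / d * P)" for E A B d P :: real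
        using assms(1) by (cases "d = 0") (auto simp: field_simps)
      then show "\<epsilon> powr (- \<alpha>) * ?k1 \<sigma> - \<alpha> * (((b - \<sigma>) / \<epsilon>) powr \<alpha> / (\<alpha> * (\<tau> - \<sigma>)) * p \<sigma>)
         = \<epsilon> powr (- \<alpha>) * (((\<tau> - \<sigma>) powr \<alpha> - (b - \<sigma>) powr \<alpha>) / (\<tau> - \<sigma>) * p \<sigma>)"
        unfolding e1 e2 .
    qed
    finally show ?thesis unfolding integral_mult_right .
  qed
  ultimately have "\<epsilon> powr (- \<alpha>) * A \<tau> - \<alpha> * J = \<epsilon> powr (- \<alpha>) *
      (integral {0..b} (\<lambda>\<sigma>. ((\<tau> - \<sigma>) powr \<alpha> - (b - \<sigma>) powr \<alpha>) / (\<tau> - \<sigma>) * p \<sigma>) + integral {b..\<tau>} ?k1)"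
    by (simp add: algebra_simps)
  with lhs show ?thesis unfolding b_def I1_def by simp
qed

text \<open>
  The tangent of a concave function lies above its graph.
\<close>
lemma powr_increment_le:
  fixes u \<epsilon> \<alpha> :: real
  assumes "0 < \<alpha>" "\<alpha> < 1" "0 < u" "0 \<le> \<epsilon>"
  shows "(u + \<epsilon>) powr \<alpha> - u powr \<alpha> \<le> \<alpha> * \<epsilon> * u powr (\<alpha> - 1)"
proof (cases "\<epsilon> = 0")
  case False
  then have "u < u + \<epsilon>" using assms by simp
  moreover have "((\<lambda>x. x powr \<alpha>) has_real_derivative \<alpha> * x powr (\<alpha> - 1)) (at x)" if "u \<le> x" for x
    using that assms by (intro has_real_derivative_powr) auto
  ultimately obtain z where z: "u < z" "(u + \<epsilon>) powr \<alpha> - u powr \<alpha> = (u + \<epsilon> - u) * (\<alpha> * z powr (\<alpha> - 1))"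
    using MVT2[of u "u + \<epsilon>" "\<lambda>x. x powr \<alpha>" "\<lambda>x. \<alpha> * x powr (\<alpha> - 1)"] by blast
  have "z powr (\<alpha> - 1) \<le> u powr (\<alpha> - 1)" using z assms by (intro powr_mono2') auto
  from mult_left_mono[OF this, of "\<alpha> * \<epsilon>"] show ?thesis using z assms by (simp add: mult_ac)
qed (use assms in auto)

text \<open>
  If p is below - \<beta> at \<tau>, it is so on some [\<tau> - \<eta>, \<tau>]. There the
  kernel is nonnegative and its part on [\<tau> - \<epsilon>, \<tau>] has mass 1 / \<alpha> for
  every \<epsilon>, while its mass on [0, \<tau> - \<eta>] is of order \<epsilon> powr (1 -
  \<alpha>). The resulting constant is not sharp; any fixed negative number serves.
\<close>
lemma marchaud_kernel_negative:
  fixes p :: "real \<Rightarrow> real"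
  assumes "0 < \<alpha>" "\<alpha> < 1" "0 < \<tau>" "0 < \<beta>" "continuous_on {0..\<tau>} p" "p \<tau> < - \<beta>"
  obtains \<epsilon> where "0 < \<epsilon>" "\<epsilon> < \<tau>"
    "\<epsilon> powr (- \<alpha>) * (integral {0..\<tau> - \<epsilon>} (\<lambda>\<sigma>. ((\<tau> - \<sigma>) powr \<alpha> - (\<tau> - \<epsilon> - \<sigma>) powr \<alpha>) / (\<tau> - \<sigma>) * p \<sigma>)
        + integral {\<tau> - \<epsilon>..\<tau>} (\<lambda>\<sigma>. (\<tau> - \<sigma>) powr (\<alpha> - 1) * p \<sigma>)) \<le> - \<beta> / (2 * \<alpha>)"
proof -
  have "bounded (p ` {0..\<tau>})"
    using assms(5) by (intro compact_imp_bounded compact_continuous_image) auto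
  then obtain Q where Q: "\<And>s. s \<in> {0..\<tau>} \<Longrightarrow> \<bar>p s\<bar> \<le> Q"
    unfolding bounded_iff by (auto simp del: atLeastAtMost_iff)
  have "Q \<ge> 0" using Q[of 0] assms(3) by auto
  have "(p \<longlongrightarrow> p \<tau>) (at \<tau> within {0..\<tau>})"
    using assms(3,5) by (auto simp: continuous_on_def)
  then have "eventually (\<lambda>s. p s < - \<beta>) (at \<tau> within {0..\<tau>})"
    using assms(6) by (rule order_tendstoD)
  then obtain \<eta>0 where \<eta>0: "\<eta>0 > 0" "\<And>s. s \<in> {0..\<tau>} \<Longrightarrow> dist s \<tau> < \<eta>0 \<Longrightarrow> s \<noteq> \<tau> \<Longrightarrow> p s < - \<beta>"
    unfolding eventually_at by blast
  define \<eta> where "\<eta> = min (\<eta>0 / 2) (\<tau> / 2)"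
  have \<eta>: "0 < \<eta>" "\<eta> < \<tau>" "\<eta> < \<eta>0" using \<eta>0 assms(3) by (auto simp: \<eta>_def)
  have neg: "p s \<le> - \<beta>" if "s \<in> {\<tau> - \<eta>..\<tau>}" for s
    using \<eta>0(2)[of s] that \<eta> assms(6) by (cases "s = \<tau>") (auto simp: dist_real_def)
  define C where "C = Q * \<tau> * \<alpha> * (\<eta> / 2) powr (\<alpha> - 1) / \<eta>"
  have "((\<lambda>\<epsilon>. C * \<epsilon> powr (1 - \<alpha>)) \<longlongrightarrow> C * 0 powr (1 - \<alpha>)) (at_right 0)"
    using assms by (intro tendsto_intros) (auto simp: eventually_at_filter)
  then have "eventually (\<lambda>\<epsilon>. C * \<epsilon> powr (1 - \<alpha>) < \<beta> / (2 * \<alpha>)) (at_right 0)"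
    using assms by (intro order_tendstoD(2)[where y="C * 0 powr (1 - \<alpha>)"]) auto
  moreover have "eventually (\<lambda>\<epsilon>. \<epsilon> \<in> {0<..<\<eta> / 2}) (at_right 0)"
    using \<eta> by (intro eventually_at_right_real) auto
  ultimately have "eventually (\<lambda>\<epsilon>. C * \<epsilon> powr (1 - \<alpha>) < \<beta> / (2 * \<alpha>) \<and> \<epsilon> \<in> {0<..<\<eta> / 2}) (at_right 0)"
    by (rule eventually_conj)
  then obtain \<epsilon> where \<epsilon>: "C * \<epsilon> powr (1 - \<alpha>) < \<beta> / (2 * \<alpha>)" "0 < \<epsilon>" "\<epsilon> < \<eta> / 2"
    using eventually_happens'[OF trivial_limit_at_right_real] by force
  let ?K = "\<lambda>\<sigma>. ((\<tau> - \<sigma>) powr \<alpha> - (\<tau> - \<epsilon> - \<sigma>) powr \<alpha>) / (\<tau> - \<sigma>)"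
  have cp: "continuous_on {u..v} p" if "0 \<le> u" "v \<le> \<tau>" for u v
    using assms(5) by (rule continuous_on_subset) (use that in auto)
  have Kint: "(\<lambda>\<sigma>. ?K \<sigma> * p \<sigma>) integrable_on {u..v}" if "0 \<le> u" "v \<le> \<tau> - \<epsilon>" for u v
    using that assms(1) \<epsilon>
    by (auto intro!: integrable_continuous_interval continuous_intros continuous_on_powr' cp)
  have Kpos: "0 \<le> ?K \<sigma>" if "\<sigma> \<le> \<tau> - \<epsilon>" for \<sigma>
    using that \<epsilon> assms(1) by (auto intro!: divide_nonneg_nonneg powr_mono2)
  have "integral {0..\<tau> - \<epsilon>} (\<lambda>\<sigma>. ?K \<sigma> * p \<sigma>)
      = integral {0..\<tau> - \<eta>} (\<lambda>\<sigma>. ?K \<sigma> * p \<sigma>) + integral {\<tau> - \<eta>..\<tau> - \<epsilon>} (\<lambda>\<sigma>. ?K \<sigma> * p \<sigma>)"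
    using \<epsilon> \<eta> Kint[of 0 "\<tau> - \<epsilon>"]
    by (intro Henstock_Kurzweil_Integration.integral_combine[symmetric]) auto
  moreover have "integral {0..\<tau> - \<eta>} (\<lambda>\<sigma>. ?K \<sigma> * p \<sigma>) \<le> C * \<epsilon>"
  proof -
    have "?K \<sigma> * p \<sigma> \<le> (\<alpha> * \<epsilon> * (\<eta> / 2) powr (\<alpha> - 1) / \<eta>) * Q" if s: "\<sigma> \<in> {0..\<tau> - \<eta>}" for \<sigma>
    proof -
      define u where "u = \<tau> - \<epsilon> - \<sigma>"
      have u: "u \<ge> \<eta> / 2" "\<tau> - \<sigma> = u + \<epsilon>" "u + \<epsilon> \<ge> \<eta>" using s \<epsilon> by (auto simp: u_def)
      have "(\<tau> - \<sigma>) powr \<alpha> - (\<tau> - \<epsilon> - \<sigma>) powr \<alpha> \<le> \<alpha> * \<epsilon> * u powr (\<alpha> - 1)"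
        unfolding u(2) u_def[symmetric]
        using u \<eta> \<epsilon> assms by (intro powr_increment_le) auto
      also have "\<dots> \<le> \<alpha> * \<epsilon> * (\<eta> / 2) powr (\<alpha> - 1)"
        using u \<eta> \<epsilon> assms by (intro mult_left_mono powr_mono2') auto
      finally have "?K \<sigma> \<le> \<alpha> * \<epsilon> * (\<eta> / 2) powr (\<alpha> - 1) / \<eta>"
        using u \<eta> \<epsilon> assms(1) by (intro frac_le) auto
      moreover have "p \<sigma> \<le> Q" "0 \<le> ?K \<sigma>" using Q[of \<sigma>] s \<eta> \<epsilon> Kpos[of \<sigma>] by auto
      ultimately show ?thesis using \<open>Q \<ge> 0\<close>
        by (meson mult_left_mono mult_right_mono order_trans)
    qed
    then have "integral {0..\<tau> - \<eta>} (\<lambda>\<sigma>. ?K \<sigma> * p \<sigma>)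
        \<le> integral {0..\<tau> - \<eta>} (\<lambda>\<sigma>. (\<alpha> * \<epsilon> * (\<eta> / 2) powr (\<alpha> - 1) / \<eta>) * Q)"
      using \<eta> \<epsilon> by (intro integral_le Kint) auto
    also have "\<dots> = (\<tau> - \<eta>) * ((\<alpha> * \<epsilon> * (\<eta> / 2) powr (\<alpha> - 1) / \<eta>) * Q)"
      using \<eta> by simp
    also have "\<dots> \<le> \<tau> * ((\<alpha> * \<epsilon> * (\<eta> / 2) powr (\<alpha> - 1) / \<eta>) * Q)"
      using \<eta> \<epsilon> assms(1) \<open>Q \<ge> 0\<close> by (intro mult_right_mono) auto
    also have "\<dots> = C * \<epsilon>" by (simp add: C_def)
    finally show ?thesis .
  qed
  moreover have "integral {\<tau> - \<eta>..\<tau> - \<epsilon>} (\<lambda>\<sigma>. ?K \<sigma> * p \<sigma>) \<le> 0"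
  proof -
    have "integral {\<tau> - \<eta>..\<tau> - \<epsilon>} (\<lambda>\<sigma>. ?K \<sigma> * p \<sigma>) \<le> integral {\<tau> - \<eta>..\<tau> - \<epsilon>} (\<lambda>\<sigma>. 0)"
    proof (intro integral_le Kint)
      fix s assume s: "s \<in> {\<tau> - \<eta>..\<tau> - \<epsilon>}"
      then have "p s \<le> 0" using neg[of s] \<epsilon> assms(4) by auto
      then show "?K s * p s \<le> 0" using Kpos[of s] s by (intro mult_nonneg_nonpos) auto
    qed (use \<eta> in auto)
    then show ?thesis by simp
  qed
  moreover have "integral {\<tau> - \<epsilon>..\<tau>} (\<lambda>\<sigma>. (\<tau> - \<sigma>) powr (\<alpha> - 1) * p \<sigma>) \<le> - \<beta> * (\<epsilon> powr \<alpha> / \<alpha>)"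
  proof -
    have I: "((\<lambda>\<sigma>. - \<beta> * (\<tau> - \<sigma>) powr (\<alpha> - 1)) has_integral
        - \<beta> * (((\<tau> - (\<tau> - \<epsilon>)) powr \<alpha> - (\<tau> - \<tau>) powr \<alpha>) / \<alpha>)) {\<tau> - \<epsilon>..\<tau>}"
      using assms(1) \<epsilon> by (intro has_integral_mult_right kernel_has_integral) auto
    have "integral {\<tau> - \<epsilon>..\<tau>} (\<lambda>\<sigma>. (\<tau> - \<sigma>) powr (\<alpha> - 1) * p \<sigma>)
        \<le> integral {\<tau> - \<epsilon>..\<tau>} (\<lambda>\<sigma>. - \<beta> * (\<tau> - \<sigma>) powr (\<alpha> - 1))"
    proof (rule integral_le)
      show "(\<lambda>\<sigma>. (\<tau> - \<sigma>) powr (\<alpha> - 1) * p \<sigma>) integrable_on {\<tau> - \<epsilon>..\<tau>}"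
        using kernel_scaleR_integrable[of \<alpha> "\<tau> - \<epsilon>" \<tau> \<tau> p] assms(1) \<epsilon> \<eta> cp[of "\<tau> - \<epsilon>" \<tau>] by auto
      show "(\<lambda>\<sigma>. - \<beta> * (\<tau> - \<sigma>) powr (\<alpha> - 1)) integrable_on {\<tau> - \<epsilon>..\<tau>}" using I by blast
      show "(\<tau> - s) powr (\<alpha> - 1) * p s \<le> - \<beta> * (\<tau> - s) powr (\<alpha> - 1)" if "s \<in> {\<tau> - \<epsilon>..\<tau>}" for s
        using neg[of s] that \<epsilon> \<eta> mult_left_mono[of "p s" "- \<beta>" "(\<tau> - s) powr (\<alpha> - 1)"]
        by (auto simp: mult.commute)
    qed
    then show ?thesis using I by (simp add: has_integral_iff)
  qed
  ultimately have "integral {0..\<tau> - \<epsilon>} (\<lambda>\<sigma>. ?K \<sigma> * p \<sigma>)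
      + integral {\<tau> - \<epsilon>..\<tau>} (\<lambda>\<sigma>. (\<tau> - \<sigma>) powr (\<alpha> - 1) * p \<sigma>) \<le> C * \<epsilon> - \<beta> * (\<epsilon> powr \<alpha> / \<alpha>)"
    by linarith
  then have "\<epsilon> powr (- \<alpha>) * (integral {0..\<tau> - \<epsilon>} (\<lambda>\<sigma>. ?K \<sigma> * p \<sigma>)
      + integral {\<tau> - \<epsilon>..\<tau>} (\<lambda>\<sigma>. (\<tau> - \<sigma>) powr (\<alpha> - 1) * p \<sigma>)) \<le> \<epsilon> powr (- \<alpha>) * (C * \<epsilon> - \<beta> * (\<epsilon> powr \<alpha> / \<alpha>))"
    by (intro mult_left_mono) auto
  also have "\<dots> = C * \<epsilon> powr (1 - \<alpha>) - \<beta> / \<alpha>"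
    using \<epsilon> by (simp add: powr_minus powr_diff field_simps)
  also have "\<dots> \<le> - \<beta> / (2 * \<alpha>)"
    using \<epsilon>(1) assms(1) by (simp add: field_simps)
  finally show ?thesis
    using that[of \<epsilon>] \<epsilon> \<eta> by simp
qed

section \<open>Decay of dissipative solutions\<close>

text \<open>
  Comparison of the squared norm with an affine function, at the first time where the two meet.
  The dissipativity hypothesis is only required along the solution and below level m + N, so
  that the lemma applies to a field that has been modified outside a ball.
\<close>
lemma dissipative_decay:
  fixes x y :: "real \<Rightarrow> 'a::euclidean_space"
  assumes "0 < \<alpha>" "\<alpha> < 1" "0 < c" "0 < \<beta>" "0 < T" "0 < N"
    and y: "continuous_on {0..T} y" and xc: "continuous_on {0..T} x"
    and x: "\<And>t. t \<in> {0..T} \<Longrightarrow> x t = x0 + c *\<^sub>R abel_integral \<alpha> y t"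
    and init: "(norm x0)\<^sup>2 < m + N"
    and diss: "\<And>t. t \<in> {0..T} \<Longrightarrow> m \<le> (norm (x t))\<^sup>2 \<Longrightarrow> (norm (x t))\<^sup>2 \<le> m + N \<Longrightarrow> x t \<bullet> y t < - \<beta>"
    and slow: "N * T powr (- \<alpha>) / (1 - \<alpha>) < c * \<beta> / \<alpha>"
    and t: "t \<in> {0..T}"
  shows "(norm (x t))\<^sup>2 \<le> m + N * (1 - t / T)"
proof (rule ccontr)
  assume neg: "\<not> ?thesis"
  define V where "V = (\<lambda>s. (norm (x s))\<^sup>2)"
  define w where "w = (\<lambda>s. m + N * (1 - s / T))"
  have x00: "x 0 = x0" using x[of 0] assms(5) by (simp add: abel_integral_def)
  have cont: "continuous_on {0..T} (\<lambda>s. V s - w s)"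
    unfolding V_def w_def using assms(5) by (intro continuous_intros xc) auto
  have V0: "V 0 - w 0 < 0" using init x00 by (simp add: V_def w_def)
  \<comment> \<open>Intermediate values: V starts strictly below w, so it cannot reach or exceed w without
    meeting it.\<close>
  have hit: "\<exists>r. 0 \<le> r \<and> r \<le> s \<and> V r - w r = 0" if "s \<in> {0..T}" "V s - w s \<ge> 0" for s
    using IVT'[of "\<lambda>s. V s - w s" 0 0 s] V0 that continuous_on_subset[OF cont, of "{0..s}"] by auto
  define Z where "Z = {s \<in> {0..T}. V s - w s = 0}"
  have "closed Z" unfolding Z_def
    by (intro continuous_closed_preimage_constant cont) auto
  moreover have "{0..T} \<inter> Z = Z" by (auto simp: Z_def)
  ultimately have "compact Z" using compact_Int_closed[of "{0..T}" Z] by simp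
  moreover have "Z \<noteq> {}"
  proof -
    have "V t - w t \<ge> 0" using neg by (simp add: V_def w_def)
    then show ?thesis using hit[OF t] t unfolding Z_def by force
  qed
  ultimately have "\<exists>s\<in>Z. \<forall>t\<in>Z. s \<le> t" by (rule compact_attains_inf)
  then obtain \<tau> where \<tau>: "\<tau> \<in> Z" "\<And>s. s \<in> Z \<Longrightarrow> \<tau> \<le> s" by blast
  have \<tau>T: "\<tau> \<in> {0..T}" "V \<tau> = w \<tau>" using \<tau>(1) by (auto simp: Z_def)
  have "\<tau> \<noteq> 0" using V0 \<tau>T by auto
  then have "0 < \<tau>" using \<tau>T by auto
  have below: "V s \<le> w s" if s: "s \<in> {0..\<tau>}" for s
  proof (rule ccontr)
    assume "\<not> V s \<le> w s"
    then obtain r where "0 \<le> r" "r \<le> s" "V r - w r = 0" using hit[of s] s \<tau>T by auto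
    then have "\<tau> \<le> s" using \<tau>(2)[of r] s \<tau>T by (auto simp: Z_def)
    then show False using \<open>\<not> V s \<le> w s\<close> s \<tau>T by auto
  qed
  define p where "p = (\<lambda>s. x \<tau> \<bullet> y s)"
  define \<phi> where "\<phi> = (\<lambda>s. x \<tau> \<bullet> x s)"
  have yc: "continuous_on {0..s} y" if "s \<le> T" for s
    using y by (rule continuous_on_subset) (use that in auto)
  have pc: "continuous_on {0..\<tau>} p" unfolding p_def using \<tau>T by (intro continuous_intros yc) auto
  have \<phi>c: "continuous_on {0..\<tau>} \<phi>" unfolding \<phi>_def
    using \<tau>T continuous_on_subset[OF xc, of "{0..\<tau>}"] by (intro continuous_intros) auto
  have \<phi>eq: "\<phi> s = x \<tau> \<bullet> x0 + c * abel_integral \<alpha> p s" if s: "s \<in> {0..\<tau>}" for s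
  proof -
    have "(\<lambda>r. (s - r) powr (\<alpha> - 1) *\<^sub>R y r) integrable_on {0..s}"
      using s \<tau>T assms by (intro kernel_scaleR_integrable yc) auto
    from integral_linear[OF this bounded_linear_inner_right[of "x \<tau>"]]
    have "abel_integral \<alpha> p s = x \<tau> \<bullet> abel_integral \<alpha> y s"
      by (simp add: abel_integral_def p_def comp_def)
    then show ?thesis using x[of s] s \<tau>T by (simp add: \<phi>_def inner_add_right)
  qed
  \<comment> \<open>Polarisation replaces the increments of V by those of a function that is affine in x; at
    the first meeting time the increments of V are at least those of w.\<close>
  have mono: "- (N / T) * (\<tau> - s) \<le> 2 * (\<phi> \<tau> - \<phi> s)" if s: "s \<in> {0..\<tau>}" for s
  proof -
    have "0 \<le> (norm (x \<tau> - x s))\<^sup>2" by simp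
    also have "\<dots> = V \<tau> + V s - 2 * \<phi> s"
      by (simp add: V_def \<phi>_def power2_norm_eq_inner inner_diff_left inner_diff_right inner_commute)
    finally have "2 * \<phi> s \<le> V \<tau> + V s" by simp
    moreover have "\<phi> \<tau> = V \<tau>" by (simp add: \<phi>_def V_def power2_norm_eq_inner)
    moreover have "V \<tau> - V s \<ge> w \<tau> - w s" using below[OF s] \<tau>T by simp
    moreover have "w \<tau> - w s = - (N / T) * (\<tau> - s)"
      using assms(5) by (simp add: w_def field_simps)
    ultimately show ?thesis by simp
  qed
  have "p \<tau> < - \<beta>" unfolding p_def
  proof (rule diss)
    have "0 \<le> N * (1 - \<tau> / T)" "N * (1 - \<tau> / T) \<le> N * 1"
      using \<tau>T assms by (auto intro!: mult_nonneg_nonneg mult_left_mono simp del: mult_1_right)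
    then show "m \<le> (norm (x \<tau>))\<^sup>2" "(norm (x \<tau>))\<^sup>2 \<le> m + N"
      using \<tau>T(2) by (auto simp: V_def w_def)
  qed (use \<tau>T in auto)
  then obtain \<epsilon> where \<epsilon>: "0 < \<epsilon>" "\<epsilon> < \<tau>" and small:
    "\<epsilon> powr (- \<alpha>) * (integral {0..\<tau> - \<epsilon>} (\<lambda>\<sigma>. ((\<tau> - \<sigma>) powr \<alpha> - (\<tau> - \<epsilon> - \<sigma>) powr \<alpha>) / (\<tau> - \<sigma>) * p \<sigma>)
        + integral {\<tau> - \<epsilon>..\<tau>} (\<lambda>\<sigma>. (\<tau> - \<sigma>) powr (\<alpha> - 1) * p \<sigma>)) \<le> - \<beta> / (2 * \<alpha>)"
    using marchaud_kernel_negative[OF assms(1,2) \<open>0 < \<tau>\<close> assms(4) pc] by blast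
  define I where "I = integral {0..\<tau> - \<epsilon>} (\<lambda>s. (\<tau> - s) powr (- \<alpha> - 1) * (\<phi> \<tau> - \<phi> s))"
  have upper: "\<tau> powr (- \<alpha>) * (\<phi> \<tau> - \<phi> 0) + \<alpha> * I \<le> c * (- \<beta> / (2 * \<alpha>))"
  proof -
    note small
    from mult_left_mono[OF this, of c] show ?thesis
      unfolding I_def
      using marchaud_identity[of \<alpha> \<epsilon> \<tau> p \<phi> "x \<tau> \<bullet> x0" c, OF assms(1,2) \<epsilon> pc \<phi>eq \<phi>c] assms(3)
      by (simp add: mult.assoc)
  qed
  have K: "((\<lambda>s. - (N / (2 * T)) * (\<tau> - s) powr (1 - \<alpha> - 1)) has_integral
      - (N / (2 * T)) * (((\<tau> - 0) powr (1 - \<alpha>) - (\<tau> - (\<tau> - \<epsilon>)) powr (1 - \<alpha>)) / (1 - \<alpha>))) {0..\<tau> - \<epsilon>}"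
    using assms(2) \<epsilon> by (intro has_integral_mult_right kernel_has_integral) auto
  have "- (N / (2 * T)) * (\<tau> powr (1 - \<alpha>) / (1 - \<alpha>))
      \<le> - (N / (2 * T)) * ((\<tau> powr (1 - \<alpha>) - \<epsilon> powr (1 - \<alpha>)) / (1 - \<alpha>))"
    using assms by (intro mult_left_mono_neg divide_right_mono) auto
  also have "\<dots> \<le> I"
  proof -
    have "integral {0..\<tau> - \<epsilon>} (\<lambda>s. - (N / (2 * T)) * (\<tau> - s) powr (1 - \<alpha> - 1)) \<le> I"
      unfolding I_def
    proof (rule integral_le)
      show "(\<lambda>s. (\<tau> - s) powr (- \<alpha> - 1) * (\<phi> \<tau> - \<phi> s)) integrable_on {0..\<tau> - \<epsilon>}"
        using \<epsilon> continuous_on_subset[OF \<phi>c, of "{0..\<tau> - \<epsilon>}"]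
        by (intro integrable_continuous_interval continuous_intros) auto
      fix s assume s: "s \<in> {0..\<tau> - \<epsilon>}"
      have "(\<tau> - s) powr (1 - \<alpha> - 1) = (\<tau> - s) powr (- \<alpha> - 1) * (\<tau> - s)"
        using powr_mult_base[of "\<tau> - s" "- \<alpha> - 1"] s \<epsilon> by (simp add: mult.commute)
      then have "- (N / (2 * T)) * (\<tau> - s) powr (1 - \<alpha> - 1)
          = (\<tau> - s) powr (- \<alpha> - 1) * (- (N / T) * (\<tau> - s) / 2)"
        by (simp add: mult_ac)
      also have "\<dots> \<le> (\<tau> - s) powr (- \<alpha> - 1) * (\<phi> \<tau> - \<phi> s)"
        using mono[of s] s \<epsilon> by (intro mult_left_mono) auto
      finally show "- (N / (2 * T)) * (\<tau> - s) powr (1 - \<alpha> - 1) \<le> (\<tau> - s) powr (- \<alpha> - 1) * (\<phi> \<tau> - \<phi> s)" .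
    qed (use K in blast)
    then show ?thesis using K by (simp add: has_integral_iff)
  qed
  finally have f1: "\<alpha> * (- (N / (2 * T)) * (\<tau> powr (1 - \<alpha>) / (1 - \<alpha>))) \<le> \<alpha> * I"
    using assms(1) by (intro mult_left_mono) auto
  have f2: "\<tau> powr (- \<alpha>) * (- (N / T) * \<tau> / 2) \<le> \<tau> powr (- \<alpha>) * (\<phi> \<tau> - \<phi> 0)"
    using mono[of 0] \<open>0 < \<tau>\<close> by (intro mult_left_mono) auto
  have f3: "\<tau> powr (- \<alpha>) * (- (N / T) * \<tau> / 2) = - (N / (2 * T)) * \<tau> powr (1 - \<alpha>)"
    using \<open>0 < \<tau>\<close> by (simp add: powr_diff powr_minus field_simps)
  define P where "P = \<tau> powr (1 - \<alpha>)"
  have "- (N / (2 * T)) * P + \<alpha> * (- (N / (2 * T)) * (P / (1 - \<alpha>))) \<le> c * (- \<beta> / (2 * \<alpha>))"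
    unfolding P_def f3[symmetric] by (rule order_trans[OF add_mono[OF f2 f1] upper])
  moreover have "- (N / (2 * T)) * P + \<alpha> * (- (N / (2 * T)) * (P / (1 - \<alpha>))) = - (N / (2 * T)) * P / (1 - \<alpha>)"
    using assms(2,5) by (simp add: divide_simps) (simp add: algebra_simps)
  ultimately have "c * \<beta> / (2 * \<alpha>) \<le> (N / (2 * T)) * P / (1 - \<alpha>)" by simp
  also have "\<dots> \<le> (N / (2 * T)) * T powr (1 - \<alpha>) / (1 - \<alpha>)"
    unfolding P_def using assms \<tau>T by (intro divide_right_mono mult_left_mono powr_mono2) auto
  also have "\<dots> = (N * T powr (- \<alpha>) / (1 - \<alpha>)) / 2"
    using assms(5) by (simp add: powr_diff powr_minus field_simps)
  also have "\<dots> < (c * \<beta> / \<alpha>) / 2" by (rule divide_strict_right_mono[OF slow]) simp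
  finally show False by simp
qed

section \<open>Well-posedness for Lipschitz nonlinearities\<close>

text \<open>
  A singular Gronwall estimate: in the norm with weight exp (s / \<delta>) the fractional
  integral has operator norm of order \<delta> powr \<alpha>, hence arbitrarily small. On the
  last stretch of length \<delta> the kernel is integrated and the weight frozen; before it the
  kernel is frozen and the weight integrated.
\<close>
lemma exp_weighted_abel_bound:
  fixes u :: "real \<Rightarrow> 'a::euclidean_space"
  assumes "0 < \<alpha>" "\<alpha> < 1" "0 < \<delta>" "0 \<le> t" "continuous_on {0..t} u" "0 \<le> D"
    and u: "\<And>s. s \<in> {0..t} \<Longrightarrow> norm (u s) \<le> D * exp (s / \<delta>)"
  shows "norm (abel_integral \<alpha> u t) \<le> D * exp (t / \<delta>) * (\<delta> powr \<alpha> * (1 / \<alpha> + 1))"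
proof -
  \<comment> \<open>The stretch of length \<delta> before t, cut off at time 0.\<close>
  define q where "q = max 0 (t - \<delta>)"
  have q: "0 \<le> q" "q \<le> t" "t - q \<le> \<delta>" using assms by (auto simp: q_def)
  let ?k = "\<lambda>s. (t - s) powr (\<alpha> - 1) *\<^sub>R u s"
  have "abel_integral \<alpha> u t = integral {0..q} ?k + integral {q..t} ?k"
    unfolding abel_integral_def using assms q
    by (intro Henstock_Kurzweil_Integration.integral_combine[symmetric] kernel_scaleR_integrable) auto
  moreover have "norm (integral {q..t} ?k) \<le> D * exp (t / \<delta>) * (((t - q) powr \<alpha> - (t - t) powr \<alpha>) / \<alpha>)"
  proof (rule norm_kernel_integral_le)
    fix s assume s: "s \<in> {q..t}"
    then have "norm (u s) \<le> D * exp (s / \<delta>)" using u q by auto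
    also have "\<dots> \<le> D * exp (t / \<delta>)" using s assms by (intro mult_left_mono) (auto intro!: divide_right_mono)
    finally show "norm (u s) \<le> D * exp (t / \<delta>)" .
  qed (use assms q in \<open>auto intro: continuous_on_subset\<close>)
  moreover have "\<dots> \<le> D * exp (t / \<delta>) * (\<delta> powr \<alpha> / \<alpha>)"
    using assms q by (intro mult_left_mono divide_right_mono) (auto intro!: powr_mono2)
  moreover have "norm (integral {0..q} ?k) \<le> D * exp (t / \<delta>) * \<delta> powr \<alpha>"
  proof (cases "t \<le> \<delta>")
    case True
    then show ?thesis using assms by (simp add: q_def)
  next
    case False
    then have qe: "q = t - \<delta>" by (simp add: q_def)
    have I: "((\<lambda>s. D * \<delta> powr (\<alpha> - 1) * exp (s / \<delta>)) has_integral
        D * \<delta> powr (\<alpha> - 1) * (\<delta> * exp (q / \<delta>) - \<delta> * exp (0 / \<delta>))) {0..q}"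
    proof (intro has_integral_mult_right fundamental_theorem_of_calculus)
      show "((\<lambda>s. \<delta> * exp (s / \<delta>)) has_vector_derivative exp (s / \<delta>)) (at s within {0..q})" for s
        using assms(3) by (auto intro!: derivative_eq_intros simp flip: has_real_derivative_iff_has_vector_derivative)
    qed (use q in auto)
    have "norm (integral {0..q} ?k) \<le> integral {0..q} (\<lambda>s. D * \<delta> powr (\<alpha> - 1) * exp (s / \<delta>))"
    proof (rule integral_norm_bound_integral)
      show "?k integrable_on {0..q}"
        using assms q by (intro kernel_scaleR_integrable) (auto intro: continuous_on_subset)
      fix s assume s: "s \<in> {0..q}"
      have "(t - s) powr (\<alpha> - 1) * norm (u s) \<le> \<delta> powr (\<alpha> - 1) * (D * exp (s / \<delta>))"
        using s q qe assms by (intro mult_mono powr_mono2' u) auto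
      then show "norm (?k s) \<le> D * \<delta> powr (\<alpha> - 1) * exp (s / \<delta>)" by (simp add: mult_ac)
    qed (use I in blast)
    also have "\<dots> = D * \<delta> powr (\<alpha> - 1) * (\<delta> * exp (q / \<delta>) - \<delta> * exp (0 / \<delta>))" using I by (simp add: has_integral_iff)
    also have "\<dots> \<le> D * \<delta> powr (\<alpha> - 1) * (\<delta> * exp (t / \<delta>) - 0)"
      using q assms by (intro mult_left_mono diff_mono) (auto intro!: divide_right_mono)
    also have "\<dots> = D * exp (t / \<delta>) * \<delta> powr \<alpha>"
      using assms(3) by (simp add: powr_diff field_simps)
    finally show ?thesis .
  qed
  ultimately have "norm (abel_integral \<alpha> u t) \<le> D * exp (t / \<delta>) * (\<delta> powr \<alpha> / \<alpha>) + D * exp (t / \<delta>) * \<delta> powr \<alpha>"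
    by (smt (verit) norm_triangle_ineq)
  then show ?thesis by (simp add: algebra_simps)
qed

lemma abel_integral_diff:
  fixes u v :: "real \<Rightarrow> 'a::euclidean_space"
  assumes "0 < \<alpha>" "\<alpha> < 1" "0 \<le> t" "continuous_on {0..t} u" "continuous_on {0..t} v"
  shows "abel_integral \<alpha> u t - abel_integral \<alpha> v t = abel_integral \<alpha> (\<lambda>s. u s - v s) t"
  unfolding abel_integral_def scaleR_right_diff_distrib
  using assms by (intro integral_diff[symmetric] kernel_scaleR_integrable) auto

lemma exists_small_weight:
  fixes \<alpha> K :: real
  assumes "0 < \<alpha>" "0 \<le> K"
  obtains \<delta> where "0 < \<delta>" "K * (\<delta> powr \<alpha> * (1 / \<alpha> + 1)) \<le> 1 / 2"
proof -
  have "((\<lambda>\<delta>. K * (\<delta> powr \<alpha> * (1 / \<alpha> + 1))) \<longlongrightarrow> K * (0 powr \<alpha> * (1 / \<alpha> + 1))) (at_right 0)"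
    using assms by (intro tendsto_intros) (auto simp: eventually_at_filter)
  then have "eventually (\<lambda>\<delta>. K * (\<delta> powr \<alpha> * (1 / \<alpha> + 1)) < 1 / 2) (at_right 0)"
    by (rule order_tendstoD) auto
  moreover have "eventually (\<lambda>\<delta>::real. \<delta> \<in> {0<..<1}) (at_right 0)"
    by (intro eventually_at_right_real) auto
  ultimately have "eventually (\<lambda>\<delta>. K * (\<delta> powr \<alpha> * (1 / \<alpha> + 1)) < 1 / 2 \<and> \<delta> \<in> {0<..<1}) (at_right 0)"
    by (rule eventually_conj)
  then obtain \<delta> where "K * (\<delta> powr \<alpha> * (1 / \<alpha> + 1)) < 1 / 2" "\<delta> \<in> {0<..<1}"
    using eventually_happens'[OF trivial_limit_at_right_real] by force
  then show ?thesis using that[of \<delta>] by auto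
qed

text \<open>
  The maximum over [0, t] of the weighted distance of two solutions is at most half of itself.
\<close>
lemma abel_equation_unique:
  fixes G :: "'a::euclidean_space \<Rightarrow> 'a" and x z :: "real \<Rightarrow> 'a"
  assumes "0 < \<alpha>" "\<alpha> < 1" "0 \<le> c" and G: "L-lipschitz_on UNIV G"
    and xc: "continuous_on {0..} x" and zc: "continuous_on {0..} z"
    and x: "\<And>t. 0 \<le> t \<Longrightarrow> x t = x0 + c *\<^sub>R abel_integral \<alpha> (\<lambda>s. G (x s)) t"
    and z: "\<And>t. 0 \<le> t \<Longrightarrow> z t = x0 + c *\<^sub>R abel_integral \<alpha> (\<lambda>s. G (z s)) t"
    and "0 \<le> t"
  shows "x t = z t"
proof -
  have "0 \<le> L" using G lipschitz_on_nonneg by blast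
  obtain \<delta> where \<delta>: "0 < \<delta>" "(c * L) * (\<delta> powr \<alpha> * (1 / \<alpha> + 1)) \<le> 1 / 2"
    using exists_small_weight[of \<alpha> "c * L"] assms \<open>0 \<le> L\<close> by auto
  define e where "e = (\<lambda>s. norm (x s - z s) / exp (s / \<delta>))"
  have Gc: "continuous_on A (\<lambda>s. G (f s))" if "continuous_on A f" for f :: "real \<Rightarrow> 'a" and A
    using continuous_on_compose2[OF lipschitz_on_continuous_on[OF G] that] by auto
  have "continuous_on {0..t} e"
    unfolding e_def using \<open>0 \<le> t\<close> continuous_on_subset[OF xc, of "{0..t}"] continuous_on_subset[OF zc, of "{0..t}"] \<delta>
    by (intro continuous_intros) auto
  then have "\<exists>s\<in>{0..t}. \<forall>r\<in>{0..t}. e r \<le> e s"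
    using \<open>0 \<le> t\<close> by (intro continuous_attains_sup) auto
  then obtain s where s: "s \<in> {0..t}" "\<And>r. r \<in> {0..t} \<Longrightarrow> e r \<le> e s" by blast
  have "0 \<le> e s" by (simp add: e_def)
  have cs: "continuous_on {0..s} x" "continuous_on {0..s} z"
    using xc zc by (auto intro: continuous_on_subset)
  have "norm (abel_integral \<alpha> (\<lambda>r. G (x r) - G (z r)) s) \<le> (L * e s) * exp (s / \<delta>) * (\<delta> powr \<alpha> * (1 / \<alpha> + 1))"
  proof (rule exp_weighted_abel_bound)
    fix r assume r: "r \<in> {0..s}"
    have "norm (G (x r) - G (z r)) \<le> L * norm (x r - z r)"
      using lipschitz_onD[OF G, of "x r" "z r"] by (simp add: dist_norm)
    also have "norm (x r - z r) = e r * exp (r / \<delta>)" by (simp add: e_def)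
    also have "L * (e r * exp (r / \<delta>)) \<le> L * (e s * exp (r / \<delta>))"
      using s(2)[of r] s(1) r \<open>0 \<le> L\<close> by (intro mult_left_mono mult_right_mono) auto
    finally show "norm (G (x r) - G (z r)) \<le> L * e s * exp (r / \<delta>)" by (simp add: mult.assoc)
  qed (use assms \<delta> s \<open>0 \<le> L\<close> \<open>0 \<le> e s\<close> in \<open>auto intro!: continuous_intros Gc cs\<close>)
  moreover have "x s - z s = c *\<^sub>R abel_integral \<alpha> (\<lambda>r. G (x r) - G (z r)) s"
    using x[of s] z[of s] s assms(1,2)
    by (simp add: abel_integral_diff[symmetric] Gc cs scaleR_right_diff_distrib)
  ultimately have "norm (x s - z s) \<le> c * ((L * e s) * exp (s / \<delta>) * (\<delta> powr \<alpha> * (1 / \<alpha> + 1)))"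
    using assms(3) by (simp add: mult_left_mono)
  also have "\<dots> = (c * L * (\<delta> powr \<alpha> * (1 / \<alpha> + 1))) * (e s * exp (s / \<delta>))" by (simp add: mult_ac)
  also have "\<dots> \<le> 1 / 2 * (e s * exp (s / \<delta>))"
    using \<delta>(2) \<open>0 \<le> e s\<close> by (intro mult_right_mono) auto
  finally have "e s \<le> 1 / 2 * e s" by (simp add: e_def)
  then have "e s = 0" using \<open>0 \<le> e s\<close> by simp
  then have "e t \<le> 0" using s(2)[of t] \<open>0 \<le> t\<close> by simp
  then show ?thesis by (simp add: e_def divide_le_0_iff)
qed

text \<open>
  Banach's fixed point theorem for the rescaled unknown exp (- t / \<delta>) * x t among bounded
  continuous functions. These functions live on the whole line, so the equation is continued to
  negative times by its value at 0.
\<close>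
lemma abel_equation_exists:
  fixes G :: "'a::euclidean_space \<Rightarrow> 'a"
  assumes "0 < \<alpha>" "\<alpha> < 1" "0 \<le> c" and G: "L-lipschitz_on UNIV G" and B: "\<And>v. norm (G v) \<le> B"
  obtains x where "continuous_on UNIV x"
    "\<And>t. 0 \<le> t \<Longrightarrow> x t = x0 + c *\<^sub>R abel_integral \<alpha> (\<lambda>s. G (x s)) t"
proof -
  have "0 \<le> L" using G lipschitz_on_nonneg by blast
  have "0 \<le> B" using B[of 0] norm_ge_zero order_trans by blast
  obtain \<delta> where \<delta>: "0 < \<delta>" "(c * L) * (\<delta> powr \<alpha> * (1 / \<alpha> + 1)) \<le> 1 / 2"
    using exists_small_weight[of \<alpha> "c * L"] assms \<open>0 \<le> L\<close> by auto
  have Gc: "continuous_on A (\<lambda>s. G (f s))" if "continuous_on A f" for f :: "real \<Rightarrow> 'a" and A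
    using continuous_on_compose2[OF lipschitz_on_continuous_on[OF G] that] by auto
  define S where "S = (\<lambda>(f :: real \<Rightarrow>\<^sub>C 'a) s. exp (s / \<delta>) *\<^sub>R f s)"
  have Sc: "continuous_on A (S f)" for f A
    unfolding S_def using \<delta> by (intro continuous_intros) auto
  define \<Psi> where "\<Psi> = (\<lambda>f t. x0 + c *\<^sub>R abel_integral \<alpha> (\<lambda>s. G (S f s)) t)"
  define \<Phi> where "\<Phi> = (\<lambda>f. Bcontfun (\<lambda>t. exp (- (max 0 t / \<delta>)) *\<^sub>R \<Psi> f (max 0 t)))"
  have bc: "(\<lambda>t. exp (- (max 0 t / \<delta>)) *\<^sub>R \<Psi> f (max 0 t)) \<in> bcontfun" for f
  proof (rule bcontfun_normI)
    have "continuous_on {0..} (\<Psi> f)"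
      unfolding \<Psi>_def using assms(1,2) by (intro continuous_intros abel_integral_continuous_on Gc Sc) auto
    then have "continuous_on UNIV (\<lambda>t. \<Psi> f (max 0 t))"
      by (rule continuous_on_compose2) (auto intro!: continuous_intros)
    then show "continuous_on UNIV (\<lambda>t. exp (- (max 0 t / \<delta>)) *\<^sub>R \<Psi> f (max 0 t))"
      using \<delta> by (intro continuous_intros) auto
    fix t :: real
    define r where "r = max 0 t"
    have "0 \<le> r" by (simp add: r_def)
    have "norm (abel_integral \<alpha> (\<lambda>s. G (S f s)) r) \<le> B * exp (r / \<delta>) * (\<delta> powr \<alpha> * (1 / \<alpha> + 1))"
    proof (rule exp_weighted_abel_bound)
      fix s assume "s \<in> {0..r}"
      then have "1 \<le> exp (s / \<delta>)" using \<delta> by simp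
      then have "B * 1 \<le> B * exp (s / \<delta>)" using \<open>0 \<le> B\<close> by (rule mult_left_mono)
      then show "norm (G (S f s)) \<le> B * exp (s / \<delta>)" using B[of "S f s"] by simp
    qed (use assms \<delta> \<open>0 \<le> r\<close> \<open>0 \<le> B\<close> in \<open>auto intro!: Gc Sc\<close>)
    then have "norm (\<Psi> f r) \<le> norm x0 + c * (B * exp (r / \<delta>) * (\<delta> powr \<alpha> * (1 / \<alpha> + 1)))"
      unfolding \<Psi>_def using assms(3)
      by (intro order_trans[OF norm_triangle_ineq] add_left_mono) (auto intro!: mult_left_mono)
    then have "exp (- (r / \<delta>)) * norm (\<Psi> f r)
        \<le> exp (- (r / \<delta>)) * (norm x0 + c * (B * exp (r / \<delta>) * (\<delta> powr \<alpha> * (1 / \<alpha> + 1))))"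
      by (rule mult_left_mono) simp
    also have "\<dots> = exp (- (r / \<delta>)) * norm x0 + c * (B * (\<delta> powr \<alpha> * (1 / \<alpha> + 1)))"
      by (simp add: distrib_left exp_minus field_simps)
    also have "\<dots> \<le> 1 * norm x0 + c * (B * (\<delta> powr \<alpha> * (1 / \<alpha> + 1)))"
      using \<delta> \<open>0 \<le> r\<close> by (intro add_right_mono mult_right_mono) auto
    finally show "norm (exp (- (max 0 t / \<delta>)) *\<^sub>R \<Psi> f (max 0 t))
        \<le> norm x0 + c * (B * (\<delta> powr \<alpha> * (1 / \<alpha> + 1)))"
      by (simp add: r_def)
  qed
  have \<Phi>: "apply_bcontfun (\<Phi> f) t = exp (- (max 0 t / \<delta>)) *\<^sub>R \<Psi> f (max 0 t)" for f t
    unfolding \<Phi>_def by (simp add: Bcontfun_inverse[OF bc])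
  have "dist (\<Phi> f) (\<Phi> h) \<le> 1 / 2 * dist f h" for f h
  proof (rule dist_bound)
    fix t :: real
    define r where "r = max 0 t"
    have "0 \<le> r" by (simp add: r_def)
    have "norm (abel_integral \<alpha> (\<lambda>s. G (S f s) - G (S h s)) r)
        \<le> (L * dist f h) * exp (r / \<delta>) * (\<delta> powr \<alpha> * (1 / \<alpha> + 1))"
    proof (rule exp_weighted_abel_bound)
      fix s
      have "norm (G (S f s) - G (S h s)) \<le> L * norm (S f s - S h s)"
        using lipschitz_onD[OF G, of "S f s" "S h s"] by (simp add: dist_norm)
      also have "norm (S f s - S h s) = exp (s / \<delta>) * dist (f s) (h s)"
        unfolding S_def scaleR_right_diff_distrib[symmetric] by (simp add: dist_norm)
      also have "L * (exp (s / \<delta>) * dist (f s) (h s)) \<le> L * (exp (s / \<delta>) * dist f h)"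
        using \<open>0 \<le> L\<close> by (intro mult_left_mono dist_bounded) auto
      finally show "norm (G (S f s) - G (S h s)) \<le> L * dist f h * exp (s / \<delta>)" by (simp add: mult_ac)
    qed (use assms \<delta> \<open>0 \<le> r\<close> \<open>0 \<le> L\<close> in \<open>auto intro!: continuous_intros Gc Sc\<close>)
    moreover have "\<Psi> f r - \<Psi> h r = c *\<^sub>R abel_integral \<alpha> (\<lambda>s. G (S f s) - G (S h s)) r"
      unfolding \<Psi>_def using assms(1,2) \<open>0 \<le> r\<close>
      by (simp add: abel_integral_diff[symmetric] Gc Sc scaleR_right_diff_distrib)
    ultimately have "norm (\<Psi> f r - \<Psi> h r) \<le> c * ((L * dist f h) * exp (r / \<delta>) * (\<delta> powr \<alpha> * (1 / \<alpha> + 1)))"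
      using assms(3) by (simp add: mult_left_mono)
    then have "exp (- (r / \<delta>)) * norm (\<Psi> f r - \<Psi> h r)
        \<le> exp (- (r / \<delta>)) * (c * ((L * dist f h) * exp (r / \<delta>) * (\<delta> powr \<alpha> * (1 / \<alpha> + 1))))"
      by (rule mult_left_mono) simp
    also have "\<dots> = (c * L * (\<delta> powr \<alpha> * (1 / \<alpha> + 1))) * dist f h"
      by (simp add: exp_minus)
    also have "\<dots> \<le> 1 / 2 * dist f h" using \<delta>(2) by (rule mult_right_mono) simp
    finally show "dist (\<Phi> f t) (\<Phi> h t) \<le> 1 / 2 * dist f h"
      unfolding \<Phi> r_def[symmetric] dist_norm scaleR_right_diff_distrib[symmetric] by simp
  qed
  then have "\<exists>!f. \<Phi> f = f" by (intro banach_fix_type[of "1 / 2"]) auto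
  then obtain f where f: "\<Phi> f = f" by blast
  show ?thesis
  proof (rule that[of "S f"])
    fix t :: real assume "0 \<le> t"
    then have "S f t = exp (t / \<delta>) *\<^sub>R exp (- (t / \<delta>)) *\<^sub>R \<Psi> f t"
      using \<Phi>[of f t] unfolding f by (simp add: S_def)
    then show "S f t = x0 + c *\<^sub>R abel_integral \<alpha> (\<lambda>s. G (S f s)) t"
      by (simp add: exp_minus \<Psi>_def)
  qed (rule Sc)
qed

lemma locally_lipschitz_imp_lipschitz_on_cball:
  fixes g :: "'a::heine_borel \<Rightarrow> 'b::metric_space"
  assumes "locally_lipschitz g"
  obtains L where "L-lipschitz_on (cball z R) g"
proof -
  have "local_lipschitz {0::real} (cball z R) (\<lambda>_. g)"
    unfolding local_lipschitz_def
  proof (intro ballI)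
    fix x t
    obtain r L where "r > 0" "L-lipschitz_on (cball x r) g"
      using assms unfolding locally_lipschitz_def by blast
    then show "\<exists>u>0. \<exists>L. \<forall>t\<in>cball t u \<inter> {0}. L-lipschitz_on (cball x u \<inter> cball z R) g"
      by (meson inf_le1 lipschitz_on_subset)
  qed
  then show ?thesis
    using local_lipschitz_compact_implies_lipschitz[where X="cball z R" and T="{0::real}" and f="\<lambda>_. g"] that
    by (auto intro: continuous_intros)
qed

lemma locally_lipschitz_continuous_on:
  assumes "locally_lipschitz g"
  shows "continuous_on A g"
proof -
  have "isCont g x" for x
  proof -
    obtain r L where "r > 0" "L-lipschitz_on (cball x r) g"
      using assms unfolding locally_lipschitz_def by blast
    then have "continuous_on (ball x r) g"
      using lipschitz_on_continuous_on continuous_on_subset ball_subset_cball by blast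
    then show ?thesis using \<open>r > 0\<close> by (simp add: continuous_on_eq_continuous_at)
  qed
  then show ?thesis by (simp add: continuous_at_imp_continuous_on)
qed

section \<open>The Volterra solution of a constant path\<close>

text \<open>
  Both bounds come from the affine comparison function; the decay bound at time t uses t itself
  as the horizon, which makes a single threshold T serve for all later times.
\<close>
lemma abel_solution_bounds:
  fixes h :: "'a::euclidean_space \<Rightarrow> 'a" and x :: "real \<Rightarrow> 'a"
  assumes "0 < \<alpha>" "\<alpha> < 1" "0 < c" "0 < \<beta>" "0 < T" "0 < N"
    and hc: "continuous_on UNIV h" and xc: "continuous_on {0..} x"
    and x: "\<And>t. 0 \<le> t \<Longrightarrow> x t = x0 + c *\<^sub>R abel_integral \<alpha> (\<lambda>s. h (x s)) t"
    and init: "(norm x0)\<^sup>2 < m + N"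
    and diss: "\<And>v. m \<le> (norm v)\<^sup>2 \<Longrightarrow> (norm v)\<^sup>2 \<le> m + N \<Longrightarrow> v \<bullet> h v < - \<beta>"
    and slow: "N * T powr (- \<alpha>) / (1 - \<alpha>) < c * \<beta> / \<alpha>"
    and "0 \<le> t"
  shows "(norm (x t))\<^sup>2 \<le> m + N" "T \<le> t \<Longrightarrow> (norm (x t))\<^sup>2 \<le> m"
proof -
  \<comment> \<open>The slowness condition improves with the horizon, so it holds at the horizon t whenever t
    is at least T.\<close>
  define T' where "T' = max t T"
  have T': "0 < T'" "T \<le> T'" "t \<in> {0..T'}" using assms by (auto simp: T'_def)
  have slow': "N * T' powr (- \<alpha>) / (1 - \<alpha>) < c * \<beta> / \<alpha>"
  proof -
    have "T' powr (- \<alpha>) \<le> T powr (- \<alpha>)" using assms T' by (intro powr_mono2') auto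
    then have "N * T' powr (- \<alpha>) / (1 - \<alpha>) \<le> N * T powr (- \<alpha>) / (1 - \<alpha>)"
      using assms by (intro divide_right_mono mult_left_mono) auto
    with slow show ?thesis by simp
  qed
  have xc': "continuous_on {0..T'} x" using xc by (rule continuous_on_subset) auto
  have "continuous_on {0..T'} (\<lambda>s. h (x s))"
    by (rule continuous_on_compose2[OF hc xc']) auto
  from dissipative_decay[OF assms(1-4) T'(1) assms(6) this xc' x init diss slow' T'(3)]
  have dec: "(norm (x t))\<^sup>2 \<le> m + N * (1 - t / T')" by auto
  have "N * (1 - t / T') \<le> N * 1" using assms T' by (intro mult_left_mono) auto
  with dec show "(norm (x t))\<^sup>2 \<le> m + N" by simp
  assume "T \<le> t"
  then have "T' = t" by (simp add: T'_def)
  with dec T' show "(norm (x t))\<^sup>2 \<le> m" by simp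
qed

text \<open>
  The radius of B* is chosen so that dissipativity is strict, with a margin, on and outside its
  boundary.
\<close>
lemma dissipative_off_ball:
  fixes v :: "'a::real_inner"
  assumes "0 < b" "dissipative a b g" "a / b + 1 \<le> (norm v)\<^sup>2"
  shows "v \<bullet> g v < - (b / 2)"
proof -
  have "v \<bullet> g v \<le> a - b * (norm v)\<^sup>2" using assms(2) by (auto simp: dissipative_def)
  also have "\<dots> \<le> a - b * (a / b + 1)" using assms by (intro diff_left_mono mult_left_mono) auto
  also have "\<dots> = - b" using assms(1) by (simp add: field_simps)
  finally show ?thesis using assms(1) by simp
qed

text \<open>
  Solutions for g and for g composed with the projection to the ball of squared radius m + N are
  the same, because the a priori bound keeps either of them in that ball. So existence and
  uniqueness pass from the bounded Lipschitz field to g, the definite description defining the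
  solution is met, and the a priori bounds hold for it.
\<close>
lemma volterra_sol_const_path:
  fixes g :: "real ^ 'n \<Rightarrow> real ^ 'n"
  assumes "0 < \<alpha>" "\<alpha> < 1" "0 < a" "0 < b" "0 < T" "0 < N"
    and g: "locally_lipschitz g" and diss: "dissipative a b g"
    and init: "(norm x0)\<^sup>2 < a / b + 1 + N"
    and slow: "N * T powr (- \<alpha>) / (1 - \<alpha>) < 1 / Gamma \<alpha> * (b / 2) / \<alpha>"
  defines "x \<equiv> volterra_sol \<alpha> g (const_path x0)"
  shows "continuous_on {0..} x"
    and "\<And>t. 0 \<le> t \<Longrightarrow> x t = x0 + (1 / Gamma \<alpha>) *\<^sub>R abel_integral \<alpha> (\<lambda>s. g (x s)) t"
    and "\<And>t. 0 \<le> t \<Longrightarrow> (norm (x t))\<^sup>2 \<le> a / b + 1 + N"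
    and "\<And>t. T \<le> t \<Longrightarrow> (norm (x t))\<^sup>2 \<le> a / b + 1"
proof -
  define c where "c = 1 / Gamma \<alpha>"
  have "0 < c" using assms(1) by (simp add: c_def Gamma_real_pos)
  define m where "m = a / b + 1"
  have "0 < m" using assms by (simp add: m_def add_pos_pos)
  define R where "R = sqrt (m + N)"
  have R: "0 \<le> R" "R\<^sup>2 = m + N" using \<open>0 < m\<close> \<open>0 < N\<close> by (auto simp: R_def)
  have inR: "v \<in> cball 0 R \<longleftrightarrow> (norm v)\<^sup>2 \<le> m + N" for v :: "real ^ 'n"
    unfolding R(2)[symmetric] using R(1) by (simp add: abs_le_square_iff[symmetric])
  define P where "P = closest_point (cball (0 :: real ^ 'n) R)"
  define G where "G = (\<lambda>v. g (P v))"
  have Pin: "P v \<in> cball 0 R" for v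
    unfolding P_def using R(1) by (intro closest_point_in_set) auto
  have PG: "G v = g v" if "(norm v)\<^sup>2 \<le> m + N" for v
    unfolding G_def P_def using that inR by (simp add: closest_point_self del: mem_cball_0)
  obtain L where L: "L-lipschitz_on (cball 0 R) g"
    using locally_lipschitz_imp_lipschitz_on_cball[OF g] by blast
  have "0 \<le> L" using L lipschitz_on_nonneg by blast
  have GL: "L-lipschitz_on UNIV G"
  proof (rule lipschitz_onI)
    fix u v
    have "dist (G u) (G v) \<le> L * dist (P u) (P v)"
      unfolding G_def using lipschitz_onD[OF L Pin Pin] .
    also have "\<dots> \<le> L * dist u v"
      unfolding P_def using R(1) \<open>0 \<le> L\<close> by (intro mult_left_mono closest_point_lipschitz) auto
    finally show "dist (G u) (G v) \<le> L * dist u v" .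
  qed fact
  have gc: "continuous_on A g" for A by (rule locally_lipschitz_continuous_on[OF g])
  have "bounded (g ` cball 0 R)"
    by (intro compact_imp_bounded compact_continuous_image gc) auto
  then obtain B where B: "norm (G v) \<le> B" for v
    unfolding bounded_iff G_def using Pin by blast
  have gd: "v \<bullet> g v < - (b / 2)" if "m \<le> (norm v)\<^sup>2" for v
    using dissipative_off_ball[OF assms(4) diss] that by (simp add: m_def)
  have Gd: "v \<bullet> G v < - (b / 2)" if "m \<le> (norm v)\<^sup>2" "(norm v)\<^sup>2 \<le> m + N" for v
    using gd[OF that(1)] PG[OF that(2)] by simp
  have "0 < b / 2" using assms by simp
  have Gc: "continuous_on UNIV G" using GL by (rule lipschitz_on_continuous_on)
  note bounds = abel_solution_bounds[OF assms(1,2) \<open>0 < c\<close> \<open>0 < b / 2\<close> assms(5,6) _ _ _ init[folded m_def] _ slow[folded c_def]]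
  have sol: "volterra_solution \<alpha> g (const_path x0) u \<longleftrightarrow> u \<in> path_space \<and>
      (\<forall>t\<ge>0. u t = x0 + c *\<^sub>R abel_integral \<alpha> (\<lambda>s. g (u s)) t)" for u
    unfolding volterra_solution_def abel_integral_def c_def const_path_def by auto
  have trunc: "abel_integral \<alpha> (\<lambda>s. g (u s)) t = abel_integral \<alpha> (\<lambda>s. G (u s)) t"
    if "\<And>s. 0 \<le> s \<Longrightarrow> (norm (u s))\<^sup>2 \<le> m + N" for u t
    unfolding abel_integral_def by (intro integral_cong) (use that in \<open>auto simp: PG\<close>)
  obtain z where zc: "continuous_on UNIV z"
    and z: "\<And>t. 0 \<le> t \<Longrightarrow> z t = x0 + c *\<^sub>R abel_integral \<alpha> (\<lambda>s. G (z s)) t"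
    using abel_equation_exists[OF assms(1,2) less_imp_le[OF \<open>0 < c\<close>] GL B] by blast
  have zc0: "continuous_on {0..} z" using zc by (rule continuous_on_subset) auto
  have zb: "(norm (z t))\<^sup>2 \<le> m + N" if "0 \<le> t" for t
    using bounds(1)[OF Gc zc0 z Gd that] .
  define w where "w = restrict z {0..}"
  have wz: "abel_integral \<alpha> (\<lambda>s. g (w s)) t = abel_integral \<alpha> (\<lambda>s. g (z s)) t" for t
    unfolding abel_integral_def by (intro integral_cong) (auto simp: w_def)
  have "continuous_on {0..} w" unfolding w_def using zc0 by (subst continuous_on_cong[OF refl]) auto
  then have w: "volterra_solution \<alpha> g (const_path x0) w"
    unfolding sol path_space_def using z trunc[of z, OF zb] wz by (auto simp: w_def)
  have uniq: "u = w" if u: "volterra_solution \<alpha> g (const_path x0) u" for u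
  proof -
    have uc: "continuous_on {0..} v" and ueq: "\<And>t. 0 \<le> t \<Longrightarrow> v t = x0 + c *\<^sub>R abel_integral \<alpha> (\<lambda>s. G (v s)) t"
      and ue: "v \<in> extensional {0..}"
      if v: "volterra_solution \<alpha> g (const_path x0) v" for v
    proof -
      show vc: "continuous_on {0..} v" and "v \<in> extensional {0..}" using v by (auto simp: sol path_space_def)
      have e: "v t = x0 + c *\<^sub>R abel_integral \<alpha> (\<lambda>s. g (v s)) t" if "0 \<le> t" for t
        using v that by (auto simp: sol)
      have "(norm (v t))\<^sup>2 \<le> m + N" if "0 \<le> t" for t
        using bounds(1)[OF gc vc e gd that] .
      then show "v t = x0 + c *\<^sub>R abel_integral \<alpha> (\<lambda>s. G (v s)) t" if "0 \<le> t" for t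
        using e[OF that] trunc[of v] by simp
    qed
    have "u t = w t" if "0 \<le> t" for t
      by (rule abel_equation_unique[OF assms(1,2) less_imp_le[OF \<open>0 < c\<close>] GL
            uc[OF u] uc[OF w] ueq[OF u] ueq[OF w] that])
    then show ?thesis using ue[OF u] ue[OF w] by (intro extensionalityI) auto
  qed
  have "x = w" unfolding x_def volterra_sol_def using w uniq by (rule the_equality)
  with w have x: "x \<in> path_space" "\<And>t. 0 \<le> t \<Longrightarrow> x t = x0 + c *\<^sub>R abel_integral \<alpha> (\<lambda>s. g (x s)) t"
    by (auto simp: sol)
  then show xc: "continuous_on {0..} x" by (simp add: path_space_def)
  show "x t = x0 + (1 / Gamma \<alpha>) *\<^sub>R abel_integral \<alpha> (\<lambda>s. g (x s)) t" if "0 \<le> t" for t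
    using x(2)[OF that] by (simp add: c_def)
  show "(norm (x t))\<^sup>2 \<le> a / b + 1 + N" if "0 \<le> t" for t
    using bounds(1)[OF gc xc x(2) gd that] by (simp add: m_def)
  show "(norm (x t))\<^sup>2 \<le> a / b + 1" if "T \<le> t" for t
    using bounds(2)[OF gc xc x(2) gd _ that] that assms(5) by (simp add: m_def)
qed

section \<open>Absorption\<close>

lemma eventually_small_neg_powr:
  fixes C e q :: real
  assumes "q < 0" "0 < e"
  obtains S where "0 < S" "\<And>s. S \<le> s \<Longrightarrow> C * s powr q < e"
proof -
  have "((\<lambda>s. C * s powr q) \<longlongrightarrow> C * 0) at_top"
    using assms by (intro tendsto_mult tendsto_const tendsto_neg_powr filterlim_ident)
  then have "eventually (\<lambda>s. C * s powr q < e) at_top"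
    using assms(2) by (intro order_tendstoD) auto
  then obtain S where "\<And>s. S \<le> s \<Longrightarrow> C * s powr q < e"
    by (auto simp: eventually_at_top_linorder)
  then show ?thesis using that[of "max S 1"] by auto
qed

lemma G_star_bound:
  fixes g :: "real ^ 'n \<Rightarrow> real ^ 'n"
  assumes "continuous_on UNIV g" "norm v \<le> delta_star a b"
  shows "norm (g v) \<le> G_star a b g"
proof -
  have "continuous_on (cball 0 (delta_star a b)) (\<lambda>y. sqrt (real CARD('n)) * norm (g y))"
    by (intro continuous_intros continuous_on_subset[OF assms(1)]) auto
  then have "bdd_above ((\<lambda>y. sqrt (real CARD('n)) * norm (g y)) ` cball 0 (delta_star a b))"
    by (intro bounded_imp_bdd_above compact_imp_bounded compact_continuous_image) auto
  then have "sqrt (real CARD('n)) * norm (g v) \<le> G_star a b g"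
    unfolding G_star_def using assms(2) by (intro cSUP_upper) auto
  moreover have "1 * norm (g v) \<le> sqrt (real CARD('n)) * norm (g v)"
    by (intro mult_right_mono) (auto simp: Suc_le_eq)
  ultimately show ?thesis by simp
qed

text \<open>
  On the boundary sphere of B* the vector g v has a strictly negative inner product with v. This
  uses that the space has a nonzero vector, as every index type is nonempty.
\<close>
lemma G_star_pos:
  fixes g :: "real ^ 'n \<Rightarrow> real ^ 'n"
  assumes "continuous_on UNIV g" "0 < a" "0 < b" "dissipative a b g"
  shows "0 < G_star a b g"
proof -
  have pos: "0 < a / b + 1" using assms by (simp add: add_pos_pos)
  obtain v :: "real ^ 'n" where v: "norm v = delta_star a b"
    using vector_choose_size[of "delta_star a b"] pos by (auto simp: delta_star_def)
  then have "(norm v)\<^sup>2 = a / b + 1" using pos by (simp add: delta_star_def)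
  then have "v \<bullet> g v < 0" using dissipative_off_ball[OF assms(3,4), of v] assms(3) by simp
  then have "0 < norm (g v)" by auto
  also have "\<dots> \<le> G_star a b g" using G_star_bound[OF assms(1), of v a b] v by simp
  finally show ?thesis .
qed

text \<open>
  The semiflow at time t applied to a constant path remembers the history on [0, t] through a
  kernel that is singular only when the most recent past is seen from \<theta> = 0. Splitting
  the history at T separates the values of g bounded by M only from those bounded by G*.
\<close>
lemma semiflow_const_path_in_B_zero:
  fixes g :: "real ^ 'n \<Rightarrow> real ^ 'n"
  assumes "0 < \<alpha>" "\<alpha> < 1" "0 < a" "0 < b" "0 < T" "0 < N"
    and g: "locally_lipschitz g" and diss: "dissipative a b g"
    and init: "(norm x0)\<^sup>2 < a / b + 1 + N"
    and slow: "N * T powr (- \<alpha>) / (1 - \<alpha>) < 1 / Gamma \<alpha> * (b / 2) / \<alpha>"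
    and M: "\<And>v. (norm v)\<^sup>2 \<le> a / b + 1 + N \<Longrightarrow> norm (g v) \<le> M"
    and t: "T < t" and fade: "M * (t - T) powr (\<alpha> - 1) \<le> G_star a b g / \<alpha>"
  shows "volterra_semiflow \<alpha> g t (const_path x0) \<in> B_zero \<alpha> a b g"
proof -
  define c where "c = 1 / Gamma \<alpha>"
  have "0 < c" using assms(1) by (simp add: c_def Gamma_real_pos)
  define x where "x = volterra_sol \<alpha> g (const_path x0)"
  note sol = volterra_sol_const_path[OF assms(1-6) g diss init slow, folded x_def c_def]
  define y where "y = (\<lambda>s. g (x s))"
  have gc: "continuous_on A g" for A by (rule locally_lipschitz_continuous_on[OF g])
  have yc: "continuous_on {p..q} y" if "0 \<le> p" for p q
    unfolding y_def
    by (rule continuous_on_compose2[OF gc[of UNIV] continuous_on_subset[OF sol(1)]]) (use that in auto)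
  have yM: "norm (y s) \<le> M" if "0 \<le> s" for s unfolding y_def using M sol(3)[OF that] .
  have "0 \<le> M" using yM[of 0] norm_ge_zero order_trans by blast
  have xd: "norm (x s) \<le> delta_star a b" if "T \<le> s" for s
    unfolding delta_star_def using sol(4)[OF that] by (rule real_le_rsqrt)
  have yG: "norm (y s) \<le> G_star a b g" if "T \<le> s" for s
    unfolding y_def by (intro G_star_bound gc xd that)
  define I where "I = (\<lambda>p q \<theta>. integral {p..q} (\<lambda>s. (t + \<theta> - s) powr (\<alpha> - 1) *\<^sub>R y s))"
  define F where "F = volterra_semiflow \<alpha> g t (const_path x0)"
  have F: "F \<theta> = x0 + c *\<^sub>R I 0 t \<theta>" if "0 \<le> \<theta>" for \<theta>
    using that t assms(5)
    by (simp add: F_def volterra_semiflow_def const_path_def I_def y_def x_def c_def)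
  have Idiff: "norm (I 0 t \<theta>2 - I 0 t \<theta>1) \<le> M / \<alpha> * (\<theta>2 - \<theta>1) powr \<alpha>" if "0 \<le> \<theta>1" "\<theta>1 \<le> \<theta>2" for \<theta>1 \<theta>2
    unfolding I_def
    using norm_kernel_integral_diff_le_powr[OF assms(1,2), of 0 t "t + \<theta>1" "t + \<theta>2" y M] that t assms(5) yc yM
    by simp
  have Ihol: "norm (I 0 t \<theta>2 - I 0 t \<theta>1) \<le> 2 * G_star a b g / \<alpha> * (\<theta>2 - \<theta>1) powr \<alpha>"
    if \<theta>: "0 \<le> \<theta>1" "\<theta>1 \<le> \<theta>2" "\<theta>2 - \<theta>1 \<le> 1" for \<theta>1 \<theta>2
  proof -
    define d where "d = \<theta>2 - \<theta>1"
    have d: "0 \<le> d" "d \<le> 1" using \<theta> by (auto simp: d_def)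
    have split: "I 0 t \<theta> = I 0 T \<theta> + I T t \<theta>" if "0 \<le> \<theta>" for \<theta>
      unfolding I_def using t that assms(1,5) yc
      by (intro Henstock_Kurzweil_Integration.integral_combine[symmetric] kernel_scaleR_integrable) auto
    have late: "norm (I T t \<theta>2 - I T t \<theta>1) \<le> G_star a b g / \<alpha> * d powr \<alpha>"
      unfolding I_def d_def
      using norm_kernel_integral_diff_le_powr[OF assms(1,2), of T t "t + \<theta>1" "t + \<theta>2" y "G_star a b g"] \<theta> t assms(5) yc yG
      by simp
    have early: "norm (I 0 T \<theta>2 - I 0 T \<theta>1) \<le> G_star a b g / \<alpha> * d powr \<alpha>"
    proof -
      define u where "u = t + \<theta>1 - T"
      have u: "0 < t - T" "t - T \<le> u" using t \<theta> by (auto simp: u_def)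
      have "norm (I 0 T \<theta>2 - I 0 T \<theta>1) \<le> M / \<alpha> *
          (((t + \<theta>1 - 0) powr \<alpha> - (t + \<theta>1 - T) powr \<alpha>) - ((t + \<theta>2 - 0) powr \<alpha> - (t + \<theta>2 - T) powr \<alpha>))"
        unfolding I_def using \<theta> t assms(1,2,5) yc yM
        by (intro norm_kernel_integral_diff_le) auto
      \<comment> \<open>Only the increment of the power at the lower, shifted argument survives; the other one
        has a favourable sign.\<close>
      also have "\<dots> \<le> M / \<alpha> * ((u + d) powr \<alpha> - u powr \<alpha>)"
      proof (intro mult_left_mono)
        have "(t + \<theta>1) powr \<alpha> \<le> (t + \<theta>2) powr \<alpha>"
          using \<theta> t assms by (intro powr_mono2) auto
        moreover have "t + \<theta>2 - T = u + d" by (simp add: u_def d_def)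
        ultimately show "((t + \<theta>1 - 0) powr \<alpha> - (t + \<theta>1 - T) powr \<alpha>) - ((t + \<theta>2 - 0) powr \<alpha> - (t + \<theta>2 - T) powr \<alpha>)
            \<le> (u + d) powr \<alpha> - u powr \<alpha>"
          unfolding u_def[symmetric] by simp
      qed (use \<open>0 \<le> M\<close> assms in auto)
      also have "\<dots> \<le> M / \<alpha> * (\<alpha> * d * u powr (\<alpha> - 1))"
        using u d \<open>0 \<le> M\<close> assms by (intro mult_left_mono powr_increment_le) auto
      also have "\<dots> = d * (M * u powr (\<alpha> - 1))" using assms(1) by simp
      also have "\<dots> \<le> d powr \<alpha> * (M * (t - T) powr (\<alpha> - 1))"
      proof (intro mult_mono)
        \<comment> \<open>This is where |\<theta>1 - \<theta>2| \<le> 1 enters.\<close>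
        show "d \<le> d powr \<alpha>" using powr_mono'[of \<alpha> 1 d] d assms by simp
        show "u powr (\<alpha> - 1) \<le> (t - T) powr (\<alpha> - 1)"
          using u assms by (intro powr_mono2') auto
      qed (use \<open>0 \<le> M\<close> in auto)
      also have "\<dots> \<le> d powr \<alpha> * (G_star a b g / \<alpha>)"
        using fade by (intro mult_left_mono) auto
      finally show ?thesis by (simp add: mult.commute)
    qed
    have "I 0 t \<theta>2 - I 0 t \<theta>1 = (I 0 T \<theta>2 - I 0 T \<theta>1) + (I T t \<theta>2 - I T t \<theta>1)"
      using split[of \<theta>1] split[of \<theta>2] \<theta> by simp
    then have "norm (I 0 t \<theta>2 - I 0 t \<theta>1) \<le> G_star a b g / \<alpha> * d powr \<alpha> + G_star a b g / \<alpha> * d powr \<alpha>"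
      using order_trans[OF norm_triangle_ineq add_mono[OF early late]] by simp
    then show ?thesis by (simp add: d_def)
  qed
  have Fdiff: "norm (F \<theta>1 - F \<theta>2) \<le> c * C * \<bar>\<theta>1 - \<theta>2\<bar> powr \<alpha>"
    if C: "norm (I 0 t (max \<theta>1 \<theta>2) - I 0 t (min \<theta>1 \<theta>2)) \<le> C * (max \<theta>1 \<theta>2 - min \<theta>1 \<theta>2) powr \<alpha>"
      and "0 \<le> \<theta>1" "0 \<le> \<theta>2" for \<theta>1 \<theta>2 C
  proof -
    have "norm (F \<theta>1 - F \<theta>2) = c * norm (I 0 t (max \<theta>1 \<theta>2) - I 0 t (min \<theta>1 \<theta>2))"
      using that(2,3) \<open>0 < c\<close>
      by (cases "\<theta>1 \<le> \<theta>2") (auto simp: F scaleR_right_diff_distrib[symmetric] norm_minus_commute)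
    also have "\<dots> \<le> c * (C * (max \<theta>1 \<theta>2 - min \<theta>1 \<theta>2) powr \<alpha>)"
      using C \<open>0 < c\<close> by (intro mult_left_mono) auto
    also have "max \<theta>1 \<theta>2 - min \<theta>1 \<theta>2 = \<bar>\<theta>1 - \<theta>2\<bar>" by auto
    finally show ?thesis by (simp add: mult.assoc)
  qed
  have "continuous_on {0..} F"
  proof (rule holder_continuous_on[OF assms(1)])
    show "norm (F u - F v) \<le> c * (M / \<alpha>) * \<bar>u - v\<bar> powr \<alpha>" if "u \<in> {0..}" "v \<in> {0..}" for u v
      using that by (intro Fdiff Idiff) auto
  qed
  moreover have "F \<in> extensional {0..}" by (simp add: F_def volterra_semiflow_def)
  ultimately have "F \<in> path_space" by (simp add: path_space_def)
  moreover have "norm (F 0) \<le> delta_star a b"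
  proof -
    have "F 0 = x t" using F[of 0] sol(2)[of t] t assms(5) by (simp add: I_def abel_integral_def y_def)
    then show ?thesis using xd t by simp
  qed
  moreover have "norm (F \<theta>1 - F \<theta>2) \<le> 2 * G_star a b g / (\<alpha> * Gamma \<alpha>) * \<bar>\<theta>1 - \<theta>2\<bar> powr \<alpha>"
    if "0 \<le> \<theta>1" "0 \<le> \<theta>2" "\<bar>\<theta>1 - \<theta>2\<bar> \<le> 1" for \<theta>1 \<theta>2
  proof -
    have "norm (F \<theta>1 - F \<theta>2) \<le> c * (2 * G_star a b g / \<alpha>) * \<bar>\<theta>1 - \<theta>2\<bar> powr \<alpha>"
      using that by (intro Fdiff Ihol) (auto simp: max_def min_def)
    then show ?thesis by (simp add: c_def mult.commute)
  qed
  ultimately show ?thesis unfolding B_zero_def F_def by auto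
qed

lemma B_zero_absorbing:
  fixes g :: "real ^ 'n \<Rightarrow> real ^ 'n"
  assumes "0 < \<alpha>" "\<alpha> < 1" "0 < a" "0 < b"
    and g: "locally_lipschitz g" and diss: "dissipative a b g"
  shows "absorbing (volterra_semiflow \<alpha> g) const_families (B_zero \<alpha> a b g)"
  unfolding absorbing_def
proof
  fix D :: "(real \<Rightarrow> real ^ 'n) set" assume "D \<in> const_families"
  then obtain D0 where D: "D = const_path ` D0" "bounded D0" by (auto simp: const_families_def)
  obtain r where r: "\<And>v. v \<in> D0 \<Longrightarrow> norm v \<le> r" using D(2) by (auto simp: bounded_iff)
  have gc: "continuous_on A g" for A by (rule locally_lipschitz_continuous_on[OF g])
  \<comment> \<open>The summand 1 keeps N positive when r = 0.\<close>
  define N where "N = r\<^sup>2 + 1"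
  have "0 < N" by (auto simp: N_def intro: add_nonneg_pos)
  have pos: "0 < a / b + 1" using assms by (simp add: add_pos_pos)
  have init: "(norm v)\<^sup>2 < a / b + 1 + N" if "v \<in> D0" for v
    using power_mono[OF r[OF that] norm_ge_zero, of 2] pos by (simp add: N_def)
  have "0 < 1 / Gamma \<alpha> * (b / 2) / \<alpha>"
    using assms by (simp add: Gamma_real_pos)
  then obtain T where T: "0 < T" "N / (1 - \<alpha>) * T powr (- \<alpha>) < 1 / Gamma \<alpha> * (b / 2) / \<alpha>"
    using eventually_small_neg_powr[of "- \<alpha>" "1 / Gamma \<alpha> * (b / 2) / \<alpha>" "N / (1 - \<alpha>)"] assms(1)
    by (metis neg_less_0_iff_less order_refl)
  define R where "R = sqrt (a / b + 1 + N)"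
  have "bounded (g ` cball 0 R)"
    by (intro compact_imp_bounded compact_continuous_image gc) auto
  then obtain M where M: "\<And>v. v \<in> cball 0 R \<Longrightarrow> norm (g v) \<le> M"
    unfolding bounded_iff by blast
  have M': "norm (g v) \<le> M" if "(norm v)\<^sup>2 \<le> a / b + 1 + N" for v
    using M[of v] real_le_rsqrt[OF that] by (simp add: R_def)
  obtain S where S: "0 < S" "\<And>s. S \<le> s \<Longrightarrow> M * s powr (\<alpha> - 1) < G_star a b g / \<alpha>"
    using eventually_small_neg_powr[of "\<alpha> - 1" "G_star a b g / \<alpha>" M] assms(1,2)
      G_star_pos[OF gc assms(3,4) diss] by (metis diff_less_0_iff_less divide_pos_pos)
  show "\<exists>T\<ge>0. \<forall>t\<ge>T. volterra_semiflow \<alpha> g t ` D \<subseteq> B_zero \<alpha> a b g"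
  proof (intro exI[of _ "T + S"] conjI allI impI)
    fix t assume t: "T + S \<le> t"
    have "volterra_semiflow \<alpha> g t (const_path v) \<in> B_zero \<alpha> a b g" if "v \<in> D0" for v
      by (rule semiflow_const_path_in_B_zero[OF assms(1-4) T(1) \<open>0 < N\<close> g diss init[OF that] _ M'])
         (use T(2) S(1) S(2)[of "t - T"] t in auto)
    then show "volterra_semiflow \<alpha> g t ` D \<subseteq> B_zero \<alpha> a b g" by (auto simp: D)
  qed (use T S in auto)
qed

section \<open>Compactness of Hoelder classes of paths\<close>

definition holder_bounded :: "real \<Rightarrow> real \<Rightarrow> real \<Rightarrow> (real \<Rightarrow> real ^ 'n) set" where
  "holder_bounded \<alpha> \<rho> C = {f \<in> path_space. norm (f 0) \<le> \<rho> \<and>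
     (\<forall>\<theta>\<^sub>1\<ge>0. \<forall>\<theta>\<^sub>2\<ge>0. \<bar>\<theta>\<^sub>1 - \<theta>\<^sub>2\<bar> \<le> 1 \<longrightarrow>
        norm (f \<theta>\<^sub>1 - f \<theta>\<^sub>2) \<le> C * \<bar>\<theta>\<^sub>1 - \<theta>\<^sub>2\<bar> powr \<alpha>)}"

text \<open>
  Steps of length at most 1 change the value by at most C.
\<close>
lemma holder_bounded_norm_le:
  assumes "0 < \<alpha>" "0 \<le> C" "f \<in> holder_bounded \<alpha> \<rho> C" "\<theta> \<in> {0..real i}"
  shows "norm (f \<theta>) \<le> \<rho> + C * real i"
  using assms(4)
proof (induction i arbitrary: \<theta>)
  case 0
  then show ?case using assms(3) by (simp add: holder_bounded_def)
next
  case (Suc i)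
  \<comment> \<open>One step of length at most 1 back into the previous interval.\<close>
  define \<eta> where "\<eta> = max 0 (\<theta> - 1)"
  have \<eta>: "\<eta> \<in> {0..real i}" "0 \<le> \<eta>" "0 \<le> \<theta>" "\<bar>\<theta> - \<eta>\<bar> \<le> 1" using Suc.prems by (auto simp: \<eta>_def)
  have "norm (f \<theta> - f \<eta>) \<le> C * \<bar>\<theta> - \<eta>\<bar> powr \<alpha>"
    using assms(3) \<eta> by (simp add: holder_bounded_def)
  also have "\<dots> \<le> C * 1"
    using \<eta> assms(1,2) by (intro mult_left_mono powr_le1) auto
  finally have "norm (f \<theta> - f \<eta>) \<le> C" by simp
  moreover have "norm (f \<theta>) \<le> norm (f \<eta>) + norm (f \<theta> - f \<eta>)"
    using norm_triangle_sub by blast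
  ultimately show ?case using Suc.IH[OF \<eta>(1)] by (simp add: algebra_simps)
qed

lemma holder_bounded_subseq_compact_interval:
  fixes \<sigma> :: "nat \<Rightarrow> real \<Rightarrow> real ^ 'n"
  assumes "0 < \<alpha>" "0 \<le> C" "\<And>n. \<sigma> n \<in> holder_bounded \<alpha> \<rho> C"
  obtains k where "strict_mono (k :: nat \<Rightarrow> nat)" "uniformly_convergent_on {0..real i} (\<lambda>n. \<sigma> (k n))"
proof -
  have "((\<lambda>d. C * d powr \<alpha>) \<longlongrightarrow> C * 0 powr \<alpha>) (at_right 0)"
    using assms(1) by (intro tendsto_intros) (auto simp: eventually_at_filter)
  then have lim: "((\<lambda>d. C * d powr \<alpha>) \<longlongrightarrow> 0) (at_right 0)" by simp
  obtain h and k :: "nat \<Rightarrow> nat" where hk: "strict_mono k"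
    "\<And>e. 0 < e \<Longrightarrow> \<exists>N. \<forall>n x. n \<ge> N \<and> x \<in> {0..real i} \<longrightarrow> norm (\<sigma> (k n) x - h x) < e"
  proof (rule Arzela_Ascoli[of "{0..real i}" \<sigma> "\<rho> + C * real i"])
    show "norm (\<sigma> n x) \<le> \<rho> + C * real i" if "x \<in> {0..real i}" for n x
      using holder_bounded_norm_le assms that by blast
    fix x e :: real assume x: "x \<in> {0..real i}" and "0 < e"
    have "eventually (\<lambda>d. C * d powr \<alpha> < e) (at_right 0)"
      using lim \<open>0 < e\<close> by (rule order_tendstoD)
    moreover have "eventually (\<lambda>d::real. d \<in> {0<..<1}) (at_right 0)"
      by (intro eventually_at_right_real) auto
    ultimately have "eventually (\<lambda>d. C * d powr \<alpha> < e \<and> d \<in> {0<..<1}) (at_right 0)"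
      by (rule eventually_conj)
    then obtain d where d: "C * d powr \<alpha> < e" "0 < d" "d < 1"
      using eventually_happens'[OF trivial_limit_at_right_real] by force
    have "norm (\<sigma> n x - \<sigma> n y) < e" if "y \<in> {0..real i}" "norm (x - y) < d" for n y
    proof -
      have "norm (\<sigma> n x - \<sigma> n y) \<le> C * \<bar>x - y\<bar> powr \<alpha>"
        using assms(3)[of n] x that d by (simp add: holder_bounded_def)
      also have "\<dots> \<le> C * d powr \<alpha>"
        using that assms(1,2) by (intro mult_left_mono powr_mono2) auto
      finally show ?thesis using d by simp
    qed
    with d show "\<exists>d>0. \<forall>n y. y \<in> {0..real i} \<and> norm (x - y) < d \<longrightarrow> norm (\<sigma> n x - \<sigma> n y) < e"
      by blast
  qed auto
  then have "uniform_limit {0..real i} (\<lambda>n. \<sigma> (k n)) h sequentially"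
    unfolding uniform_limit_sequentially_iff dist_norm by blast
  with hk(1) show ?thesis using that by (auto simp: uniformly_convergent_on_def)
qed

text \<open>
  Diagonal argument over the intervals [0, i]; the property is stable under passing to a
  sequence that is eventually a subsequence.
\<close>
lemma holder_bounded_subseq_locally_uniform:
  fixes \<sigma> :: "nat \<Rightarrow> real \<Rightarrow> real ^ 'n"
  assumes "0 < \<alpha>" "0 \<le> C" "\<And>n. \<sigma> n \<in> holder_bounded \<alpha> \<rho> C"
  obtains k where "strict_mono (k :: nat \<Rightarrow> nat)"
    "\<forall>i :: nat. uniformly_convergent_on {0..real i} (\<lambda>n. \<sigma> (k n))"
proof (rule subsequence_diagonalization_lemma
    [of "\<lambda>i r. uniformly_convergent_on {0..real i} (\<lambda>n. \<sigma> (r n))" id])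
  fix i and r :: "nat \<Rightarrow> nat"
  show "\<exists>k. strict_mono k \<and> uniformly_convergent_on {0..real i} (\<lambda>n. \<sigma> ((r \<circ> k) n))"
    using holder_bounded_subseq_compact_interval[of \<alpha> C "\<lambda>n. \<sigma> (r n)" \<rho> i] assms by auto
next
  fix i N and r k1 k2 :: "nat \<Rightarrow> nat"
  assume c: "uniformly_convergent_on {0..real i} (\<lambda>n. \<sigma> ((r \<circ> k1) n))"
    and sub: "\<And>j. N \<le> j \<Longrightarrow> \<exists>j'\<ge>j. k2 j = k1 j'"
  from c obtain h where h: "\<And>e. 0 < e \<Longrightarrow> \<exists>M. \<forall>n\<ge>M. \<forall>x\<in>{0..real i}. dist (\<sigma> (r (k1 n)) x) (h x) < e"
    unfolding uniformly_convergent_on_def uniform_limit_sequentially_iff by auto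
  have "\<exists>M. \<forall>n\<ge>M. \<forall>x\<in>{0..real i}. dist (\<sigma> (r (k2 n)) x) (h x) < e" if "0 < e" for e
  proof -
    from h[OF that] obtain M where M: "\<And>n x. M \<le> n \<Longrightarrow> x \<in> {0..real i} \<Longrightarrow> dist (\<sigma> (r (k1 n)) x) (h x) < e"
      by blast
    have "dist (\<sigma> (r (k2 n)) x) (h x) < e" if n: "max M N \<le> n" and x: "x \<in> {0..real i}" for n x
    proof -
      from sub[of n] n obtain j where "n \<le> j" "k2 n = k1 j" by auto
      with M[of j x] n x show ?thesis by auto
    qed
    then show ?thesis by blast
  qed
  then show "uniformly_convergent_on {0..real i} (\<lambda>n. \<sigma> ((r \<circ> k2) n))"
    unfolding uniformly_convergent_on_def uniform_limit_sequentially_iff by auto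
next
  fix k :: "nat \<Rightarrow> nat"
  assume "strict_mono k" "\<And>i. uniformly_convergent_on {0..real i} (\<lambda>n. \<sigma> ((id \<circ> k) n))"
  then show thesis by (intro that[of k]) simp_all
qed

text \<open>
  Termwise convergence of the series that defines the metric suffices, since its terms are
  dominated by a geometric series.
\<close>
lemma path_limit_if_locally_uniform:
  fixes \<sigma> :: "nat \<Rightarrow> real \<Rightarrow> real ^ 'n"
  assumes \<sigma>: "\<And>n. \<sigma> n \<in> path_space" and l: "l \<in> path_space"
    and u: "\<And>i :: nat. uniform_limit {0..real i} \<sigma> l sequentially"
  shows "limitin path.mtopology \<sigma> l sequentially"
proof -
  have sup0: "(\<lambda>n. sup_dist (real k) (\<sigma> n) l) \<longlonglongrightarrow> 0" for k
    unfolding lim_sequentially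
  proof (intro allI impI)
    fix e :: real assume "0 < e"
    then obtain N where N: "\<And>n x. N \<le> n \<Longrightarrow> x \<in> {0..real k} \<Longrightarrow> dist (\<sigma> n x) (l x) < e / 2"
      using u[of k] unfolding uniform_limit_sequentially_iff by (meson half_gt_zero)
    have "dist (sup_dist (real k) (\<sigma> n) l) 0 < e" if "N \<le> n" for n
    proof -
      have "sup_dist (real k) (\<sigma> n) l \<le> e / 2"
        unfolding sup_dist_def using N[OF that] by (intro cSUP_least) (auto simp: dist_norm less_imp_le)
      then show ?thesis using sup_dist_nonneg[OF \<sigma> l, of "real k" n] \<open>0 < e\<close> by simp
    qed
    then show "\<exists>N. \<forall>n\<ge>N. dist (sup_dist (real k) (\<sigma> n) l) 0 < e" by blast
  qed
  let ?a = "\<lambda>k n. 1 / 2 ^ Suc k * (sup_dist (real (Suc k)) (\<sigma> n) l / (1 + sup_dist (real (Suc k)) (\<sigma> n) l))"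
  have "(\<lambda>n. suminf (\<lambda>k. ?a k n)) \<longlonglongrightarrow> suminf (\<lambda>k::nat. 0 :: real)"
  proof (rule tannerys_theorem[THEN conjunct2, THEN conjunct2])
    fix k
    have "(\<lambda>n. ?a k n) \<longlonglongrightarrow> 1 / 2 ^ Suc k * (0 / (1 + 0))"
      by (intro tendsto_intros sup0) auto
    then show "(\<lambda>n. ?a k n) \<longlonglongrightarrow> 0" by simp
  next
    have "norm (?a k n) \<le> (1 / 2) ^ Suc k" for k n
    proof -
      have nn: "0 \<le> sup_dist (real (Suc k)) (\<sigma> n) l" by (intro sup_dist_nonneg \<sigma> l) auto
      then have "1 / 2 ^ Suc k * (sup_dist (real (Suc k)) (\<sigma> n) l / (1 + sup_dist (real (Suc k)) (\<sigma> n) l)) \<le> 1 / 2 ^ Suc k * 1"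
        by (intro mult_left_mono) auto
      with nn show ?thesis by (simp add: power_one_over)
    qed
    then show "\<forall>\<^sub>F (k, n) in at_top \<times>\<^sub>F sequentially. norm (?a k n) \<le> (1 / 2) ^ Suc k"
      by (auto intro!: always_eventually)
    show "summable (\<lambda>k. (1 / 2 :: real) ^ Suc k)"
      using summable_geometric[of "1 / 2 :: real"] by (subst summable_Suc_iff) simp
  qed simp
  moreover have "(\<lambda>n. norm (\<sigma> n 0 - l 0)) \<longlonglongrightarrow> 0"
    using tendsto_uniform_limitI[OF u[of 0], of 0] by (simp add: LIM_zero tendsto_norm_zero)
  ultimately have "(\<lambda>n. norm (\<sigma> n 0 - l 0) + suminf (\<lambda>k. ?a k n)) \<longlonglongrightarrow> 0 + suminf (\<lambda>k::nat. 0 :: real)"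
    by (intro tendsto_add)
  then have "(\<lambda>n. path_dist (\<sigma> n) l) \<longlonglongrightarrow> 0"
    unfolding path_dist_def using \<sigma> l by simp
  then show ?thesis
    using \<sigma> l by (simp add: path.limit_metric_sequentially path.limitin_metric_dist_null)
qed

lemma holder_bounded_compactin:
  assumes "0 < \<alpha>" "0 \<le> C"
  shows "compactin path.mtopology (holder_bounded \<alpha> \<rho> C :: (real \<Rightarrow> real ^ 'n) set)"
  unfolding path.compactin_sequentially
proof (intro conjI allI impI)
  show "holder_bounded \<alpha> \<rho> C \<subseteq> (path_space :: (real \<Rightarrow> real ^ 'n) set)"
    by (auto simp: holder_bounded_def)
  fix \<sigma> :: "nat \<Rightarrow> real \<Rightarrow> real ^ 'n" assume "range \<sigma> \<subseteq> holder_bounded \<alpha> \<rho> C"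
  then have \<sigma>: "\<sigma> n \<in> holder_bounded \<alpha> \<rho> C" for n by auto
  then have \<sigma>p: "\<sigma> n \<in> path_space" for n by (auto simp: holder_bounded_def)
  obtain k where k: "strict_mono (k :: nat \<Rightarrow> nat)"
    and uc: "\<forall>i :: nat. uniformly_convergent_on {0..real i} (\<lambda>n. \<sigma> (k n))"
    by (rule holder_bounded_subseq_locally_uniform[OF assms, of \<sigma> \<rho>, OF \<sigma>])
  define l where "l = (\<lambda>\<theta>\<in>{0..}. lim (\<lambda>n. \<sigma> (k n) \<theta>))"
  have ul: "uniform_limit {0..real i} (\<lambda>n. \<sigma> (k n)) l sequentially" for i :: nat
  proof -
    have "uniform_limit {0..real i} (\<lambda>n. \<sigma> (k n)) (\<lambda>\<theta>. lim (\<lambda>n. \<sigma> (k n) \<theta>)) sequentially"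
      using uc by (simp add: uniformly_convergent_uniform_limit_iff)
    then show ?thesis by (rule uniform_limit_cong'[THEN iffD1, rotated 2]) (auto simp: l_def)
  qed
  have pt: "(\<lambda>n. \<sigma> (k n) \<theta>) \<longlonglongrightarrow> l \<theta>" if "0 \<le> \<theta>" for \<theta>
  proof -
    obtain i :: nat where "\<theta> \<le> real i" using real_arch_simple by blast
    then show ?thesis using tendsto_uniform_limitI[OF ul[of i], of \<theta>] that by simp
  qed
  have hol: "norm (l \<theta>1 - l \<theta>2) \<le> C * \<bar>\<theta>1 - \<theta>2\<bar> powr \<alpha>" if "0 \<le> \<theta>1" "0 \<le> \<theta>2" "\<bar>\<theta>1 - \<theta>2\<bar> \<le> 1" for \<theta>1 \<theta>2
  proof (rule Lim_bounded)
    show "(\<lambda>n. norm (\<sigma> (k n) \<theta>1 - \<sigma> (k n) \<theta>2)) \<longlonglongrightarrow> norm (l \<theta>1 - l \<theta>2)"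
      using that by (intro tendsto_intros pt)
    show "\<forall>n\<ge>0. norm (\<sigma> (k n) \<theta>1 - \<sigma> (k n) \<theta>2) \<le> C * \<bar>\<theta>1 - \<theta>2\<bar> powr \<alpha>"
      using \<sigma> that by (simp add: holder_bounded_def)
  qed
  have "norm (l 0) \<le> \<rho>"
  proof (rule Lim_bounded)
    show "(\<lambda>n. norm (\<sigma> (k n) 0)) \<longlonglongrightarrow> norm (l 0)" by (intro tendsto_intros pt) simp
    show "\<forall>n\<ge>0. norm (\<sigma> (k n) 0) \<le> \<rho>" using \<sigma> by (simp add: holder_bounded_def)
  qed
  moreover have "continuous_on {0..} l"
    unfolding continuous_on_eq_continuous_within
  proof
    fix t :: real assume t: "t \<in> {0..}"
    obtain i :: nat where i: "t < real i" using reals_Archimedean2 by blast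
    have "continuous_on {0..real i} (\<sigma> n)" for n
      using \<sigma>p[of n] by (auto simp: path_space_def intro: continuous_on_subset)
    then have "continuous_on {0..real i} l"
      by (intro uniform_limit_theorem[OF _ ul] always_eventually) auto
    then have "continuous (at t within {0..real i}) l"
      using t i by (simp add: continuous_on_eq_continuous_within)
    moreover have "at t within {0..real i} = at t within {0..}"
      by (rule at_within_nhd[of t "{..<real i}"]) (use i in auto)
    ultimately show "continuous (at t within {0..}) l" by (simp add: continuous_within)
  qed
  moreover have "l \<in> extensional {0..}" by (simp add: l_def)
  ultimately have l: "l \<in> holder_bounded \<alpha> \<rho> C"
    using hol by (simp add: holder_bounded_def path_space_def)
  moreover have "limitin path.mtopology (\<sigma> \<circ> k) l sequentially"
    using l ul \<sigma>p unfolding comp_def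
    by (intro path_limit_if_locally_uniform) (auto simp: holder_bounded_def)
  ultimately show "\<exists>l r. l \<in> holder_bounded \<alpha> \<rho> C \<and> strict_mono r \<and> limitin path.mtopology (\<sigma> \<circ> r) l sequentially"
    using k by blast
qed

lemma (in Metric_space) compactin_imp_precompact_in:
  assumes "compactin mtopology S"
  shows "precompact_in S"
proof -
  have "closedin mtopology S"
    using assms Hausdorff_space_mtopology compactin_imp_closedin by blast
  then show ?thesis
    using assms compactin_subspace[of mtopology S] by (simp add: precompact_in_def closure_of_closedin)
qed

section \<open>The absorbing set\<close>

lemma B_zero_eq_holder_bounded:
  "B_zero \<alpha> a b g = holder_bounded \<alpha> (delta_star a b) (2 * G_star a b g / (\<alpha> * Gamma \<alpha>))"
  unfolding B_zero_def holder_bounded_def ..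

theorem theorem4p5:
  fixes \<alpha> a b :: real and g :: "real ^ 'n \<Rightarrow> real ^ 'n"
  assumes "0 < \<alpha>" "\<alpha> < 1" "0 < a" "0 < b"
    and "locally_lipschitz g"
    and "dissipative a b g"
  shows "absorbing (volterra_semiflow \<alpha> g) const_families (B_zero \<alpha> a b g) \<and>
         path.precompact_in (B_zero \<alpha> a b g)"
proof
  show "absorbing (volterra_semiflow \<alpha> g) const_families (B_zero \<alpha> a b g)"
    by (rule B_zero_absorbing[OF assms])
  have "0 < G_star a b g"
    using G_star_pos[OF locally_lipschitz_continuous_on] assms by blast
  then have "0 \<le> 2 * G_star a b g / (\<alpha> * Gamma \<alpha>)"
    using assms(1) by (simp add: Gamma_real_pos less_imp_le)
  then show "path.precompact_in (B_zero \<alpha> a b g)"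
    unfolding B_zero_eq_holder_bounded
    by (intro path.compactin_imp_precompact_in holder_bounded_compactin assms(1))
qed

end
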